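(* Let $\lambda$, $\kappa$, $\Theta_0$ (open), $M_0$ and $\{P_{\boldsymbol\theta}\}_{\boldsymbol\theta\in\Theta_0}$ be as in the context. Let $\Theta$ be a convex relatively closed subset of the open set $\Theta_0$, and let $\boldsymbol\theta_0\in\Theta$. Let $\boldsymbol x_1,\boldsymbol x_2,\ldots$ be i.i.d. with law $P_{\boldsymbol\theta_0}$, $\bar{\boldsymbol x}_n=\frac1n\sum_{i=1}^n\boldsymbol x_i$, and suppose that, for every $n$, $\bar{\boldsymbol x}_n$ takes values in $M_0$ almost surely. Then there is a unique maximum likelihood estimator $\varphi_\Theta$ constrained to $\Theta$ defined in $M_0$, and the sequence of laws of $\{\varphi_\Theta(\bar{\boldsymbol x}_n)\}_{n\in\mathbb N}$ satisfies the large deviation principle on $\Theta$ with rate function $$I(\boldsymbol\theta)=D(\boldsymbol\theta||\boldsymbol\theta_0),\qquad\boldsymbol\theta\in\Theta.$$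
   Context: Setting: $\lambda$ is a $\sigma$-finite Borel measure on $\mathbb R^d$, not concentrated on a proper affine submanifold of $\mathbb R^d$. Its cumulant generating function is $\kappa(\boldsymbol\theta)=\log\int_{\mathbb R^d}e^{\boldsymbol\theta\cdot\boldsymbol x}\lambda(d\boldsymbol x)\in(-\infty,+\infty]$, and its domain of finiteness $\Theta_0=\{\boldsymbol\theta:\kappa(\boldsymbol\theta)<\infty\}$ is assumed to be (nonempty and) open. The exponential family is $\frac{dP_{\boldsymbol\theta}}{d\lambda}(\boldsymbol x)=e^{\boldsymbol\theta\cdot\boldsymbol x-\kappa(\boldsymbol\theta)}$, $\boldsymbol\theta\in\Theta_0$. $M_0=\nabla\kappa(\Theta_0)$, which is the interior of the convex support of $\lambda$ (the smallest closed convex set whose complement is $\lambda$-null); $\nabla\kappa:\Theta_0\to M_0$ is a diffeomorphism with inverse $\nabla\kappa^*$, where $\kappa^*(\boldsymbol t)=\sup_{\boldsymbol\theta}\{\boldsymbol\theta\cdot\boldsymbol t-\kappa(\boldsymbol\theta)\}$. $D(\boldsymbol\theta_1||\boldsymbol\theta_2)=\int\log\frac{dP_{\boldsymbol\theta_1}}{dP_{\boldsymbol\theta_2}}\,dP_{\boldsymbol\theta_1}$ is the Kullback-Leibler divergence of $P_{\boldsymbol\theta_1}$ with respect to $P_{\boldsymbol\theta_2}$. An $m$-projection of $\boldsymbol\theta_1$ on $\Theta$ is any minimizer of $\boldsymbol\theta\mapsto D(\boldsymbol\theta_1||\boldsymbol\theta)$ over $\boldsymbol\theta\in\Theta$. A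 maximum likelihood estimator (MLE) constrained to $\Theta$ is a Borel function $\varphi_\Theta$ on $M_0$ such that, for every $\boldsymbol t\in M_0$, $\varphi_\Theta(\boldsymbol t)$ is an $m$-projection of $\nabla\kappa^*(\boldsymbol t)$ on $\Theta$ (equivalently, a maximizer over $\boldsymbol\theta\in\Theta$ of $\boldsymbol\theta\cdot\boldsymbol t-\kappa(\boldsymbol\theta)$). A sequence $\{\phi_n\}$ of probability measures on a topological space $\mathcal X$ satisfies the large deviation principle (LDP) with rate function $I:\mathcal X\to[0,+\infty]$ if $I$ is lower semi-continuous with compact sub-level sets $\{I\le\eta\}$, $\eta\ge0$ (all rate functions are good), and for every Borel $A\subset\mathcal X$, $-\inf_{\mathrm{int}(A)}I\le\liminf_n n^{-1}\ln\phi_n(A)\le\limsup_n n^{-1}\ln\phi_n(A)\le-\inf_{\bar A}I$. *)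

theory Defs
  imports "HOL-Probability.Probability"
begin

definition ln_ennreal :: "ennreal \<Rightarrow> ereal" where
  "ln_ennreal u = (if u = 0 then - \<infinity> else if u = \<top> then \<infinity> else ereal (ln (enn2real u)))"

definition cgf :: "'a::euclidean_space measure \<Rightarrow> 'a \<Rightarrow> ereal" where
  "cgf lam \<theta> = ln_ennreal (\<integral>\<^sup>+ x. ennreal (exp (\<theta> \<bullet> x)) \<partial>lam)"

definition cgf_domain :: "'a::euclidean_space measure \<Rightarrow> 'a set" where
  "cgf_domain lam = {\<theta>. cgf lam \<theta> < \<infinity>}"

text \<open>Gradient of an extended-real function; only meaningful at points near which the function
  is finite and at which it is differentiable.\<close>

definition grad :: "('a::euclidean_space \<Rightarrow> ereal) \<Rightarrow> 'a \<Rightarrow> 'a" where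
  "grad f x = (THE D. GDERIV (\<lambda>y. real_of_ereal (f y)) x :> D)"

definition mean_domain :: "'a::euclidean_space measure \<Rightarrow> 'a set" where
  "mean_domain lam = grad (cgf lam) ` cgf_domain lam"

definition cgf_conjugate :: "'a::euclidean_space measure \<Rightarrow> 'a \<Rightarrow> ereal" where
  "cgf_conjugate lam t = (SUP \<theta>. ereal (\<theta> \<bullet> t) - cgf lam \<theta>)"

definition exp_family :: "'a::euclidean_space measure \<Rightarrow> 'a \<Rightarrow> 'a measure" where
  "exp_family lam \<theta> = density lam (\<lambda>x. ennreal (exp (\<theta> \<bullet> x - real_of_ereal (cgf lam \<theta>))))"

text \<open>The library's \<open>KL_divergence b M N\<close> is the divergence of \<open>N\<close> with respect to \<open>M\<close>,
  hence the swapped arguments.\<close>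

definition KL_param :: "'a::euclidean_space measure \<Rightarrow> 'a \<Rightarrow> 'a \<Rightarrow> real" where
  "KL_param lam \<theta>\<^sub>1 \<theta>\<^sub>2 = KL_divergence (exp 1) (exp_family lam \<theta>\<^sub>2) (exp_family lam \<theta>\<^sub>1)"

definition m_projection :: "'a::euclidean_space measure \<Rightarrow> 'a set \<Rightarrow> 'a \<Rightarrow> 'a \<Rightarrow> bool" where
  "m_projection lam \<Theta> \<theta>\<^sub>1 \<theta> \<longleftrightarrow> is_arg_min (KL_param lam \<theta>\<^sub>1) (\<lambda>\<theta>'. \<theta>' \<in> \<Theta>) \<theta>"

text \<open>The estimator is a function on \<^term>\<open>mean_domain lam\<close>; its values elsewhere are not
  constrained here.\<close>

definition constrained_MLE :: "'a::euclidean_space measure \<Rightarrow> 'a set \<Rightarrow> ('a \<Rightarrow> 'a) \<Rightarrow> bool" where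
  "constrained_MLE lam \<Theta> \<phi> \<longleftrightarrow>
     \<phi> \<in> borel_measurable (restrict_space borel (mean_domain lam)) \<and>
     (\<forall>t\<in>mean_domain lam. m_projection lam \<Theta> (grad (cgf_conjugate lam) t) (\<phi> t))"

definition good_rate_function :: "'b topology \<Rightarrow> ('b \<Rightarrow> ereal) \<Rightarrow> bool" where
  "good_rate_function X I \<longleftrightarrow>
     (\<forall>x\<in>topspace X. 0 \<le> I x) \<and>
     (\<forall>a. closedin X {x \<in> topspace X. I x \<le> a}) \<and>
     (\<forall>\<eta>::real. 0 \<le> \<eta> \<longrightarrow> compactin X {x \<in> topspace X. I x \<le> ereal \<eta>})"

text \<open>Sequences are indexed from 1, so nothing is required of \<^term>\<open>\<mu> 0\<close>. The infimum over the
  empty set is \<open>\<infinity>\<close>.\<close>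

definition LDP :: "'b topology \<Rightarrow> (nat \<Rightarrow> 'b measure) \<Rightarrow> ('b \<Rightarrow> ereal) \<Rightarrow> bool" where
  "LDP X \<mu> I \<longleftrightarrow>
     (\<forall>n\<ge>1. prob_space (\<mu> n) \<and> space (\<mu> n) = topspace X \<and>
             sets (\<mu> n) = sigma_sets (topspace X) {U. openin X U}) \<and>
     good_rate_function X I \<and>
     (\<forall>A \<in> sigma_sets (topspace X) {U. openin X U}.
        - (INF x \<in> X interior_of A. I x)
          \<le> liminf (\<lambda>n. ereal (1 / real n) * ln_ennreal (emeasure (\<mu> n) A)) \<and>
        limsup (\<lambda>n. ereal (1 / real n) * ln_ennreal (emeasure (\<mu> n) A))
          \<le> - (INF x \<in> X closure_of A. I x))"

definition sample_mean :: "(nat \<Rightarrow> 'w \<Rightarrow> 'a::euclidean_space) \<Rightarrow> nat \<Rightarrow> 'w \<Rightarrow> 'a" where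
  "sample_mean x n \<omega> = (\<Sum>i=1..n. x i \<omega>) /\<^sub>R real n"

text \<open>As \<^term>\<open>\<phi>\<close> is only defined on \<^term>\<open>mean_domain lam\<close>, the law of the sample mean is first
  restricted to that set, which has full measure when the sample mean lies in it almost surely.\<close>

definition estimator_law ::
  "'w measure \<Rightarrow> 'a::euclidean_space measure \<Rightarrow> 'a set \<Rightarrow> ('a \<Rightarrow> 'a) \<Rightarrow> (nat \<Rightarrow> 'w \<Rightarrow> 'a) \<Rightarrow> nat \<Rightarrow> 'a measure"
where
  "estimator_law M lam \<Theta> \<phi> x n =
     distr (restrict_space (distr M borel (sample_mean x n)) (mean_domain lam))
           (restrict_space borel \<Theta>) \<phi>"

end

theory Submission
  imports Defs
begin

text \<open>Write \<open>\<kappa>\<close> for the cumulant function, \<open>mean_param \<theta>\<close> for the mean of \<open>P\<^sub>\<theta>\<close>, which is the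
  gradient of \<open>\<kappa>\<close>, and \<open>llr \<theta> \<theta>\<^sub>0 y = (\<theta> - \<theta>\<^sub>0) \<bullet> y - \<kappa> \<theta> + \<kappa> \<theta>\<^sub>0\<close> for the log-likelihood ratio
  of one observation. The likelihood ratio of \<open>n\<close> observations depends only on their mean \<open>y\<close> and
  equals \<open>exp (n * llr \<theta> \<theta>\<^sub>0 y)\<close>; hence this function has integral \<open>1\<close> under the law of the sample
  mean, for every \<open>\<theta>\<close> in the natural parameter domain (\<open>likelihood_ratio_sample_mean\<close>). Both large
  deviation bounds follow from this family of identities and the geometry of the estimator, without
  a detour through a large deviation principle for the sample mean itself.

  Upper bound. By Markov's inequality the half-space \<open>{y. c < llr \<theta> \<theta>\<^sub>0 y}\<close> has probability at most
  \<open>exp (- n * c)\<close>. If \<open>\<theta>\<close> is the estimate at \<open>t\<close>, the variational inequality for minimizing over a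
  convex set gives \<open>D(\<theta>||\<theta>\<^sub>0) \<le> llr \<theta> \<theta>\<^sub>0 t\<close> (\<open>KL_mle_le_llr\<close>), so that \<open>t\<close> lies in this half-space
  whenever \<open>c < D(\<theta>||\<theta>\<^sub>0)\<close>. The preimage of a closed set of parameters is closed only relative to the
  mean domain; but at points outside the mean domain \<open>llr \<theta> \<theta>\<^sub>0\<close> is unbounded in \<open>\<theta>\<close>
  (\<open>llr_unbounded_outside\<close>), because almost every observation lies in the mean domain. By compactness
  finitely many half-spaces cover the closure of the preimage (\<open>finite_halfspace_cover\<close>), and their
  number does not affect the exponential rate. The same geometry makes the sublevel sets of the rate
  function compact (\<open>compact_KL_sublevel\<close>).

  Lower bound. The density \<open>exp (n * llr \<theta> \<theta>\<^sub>0 y)\<close> turns the law of the sample mean into the one under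
  \<open>P\<^sub>\<theta>\<close>, which concentrates at \<open>mean_param \<theta>\<close>, where the density is \<open>exp (n * D(\<theta>||\<theta>\<^sub>0))\<close>. So a
  ball around \<open>mean_param \<theta>\<close> has probability at least about \<open>exp (- n * D(\<theta>||\<theta>\<^sub>0))\<close>
  (\<open>ball_lower_bound\<close>). For \<open>\<theta>\<close> in the constraint set, the estimator maps \<open>mean_param \<theta>\<close> to \<open>\<theta>\<close>,
  and it is continuous, so a small ball goes into any given neighbourhood of \<open>\<theta>\<close>.

  The estimate at \<open>t\<close> minimizes \<open>\<kappa> \<theta> - \<theta> \<bullet> t\<close>. This function is strictly convex
  (\<open>strict_subgradient\<close>), so it grows linearly away from a minimizer (\<open>is_mle_growth\<close>); and its
  sublevel sets are closed in the whole space by Fatou's lemma. Together these give compact sublevel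
  sets and hence existence; and since linear growth absorbs small changes of \<open>t\<close>, also continuity of
  the estimator. For the full natural parameter domain the same argument shows that the mean domain
  is open and that \<open>mean_param\<close> has a continuous inverse, the gradient of the conjugate of \<open>\<kappa>\<close>.\<close>

section \<open>Gradients, growth and coordinates\<close>

text \<open>The subgradient inequalities at \<open>x\<close> and at a nearby \<open>y\<close> trap the first-order remainder at \<open>x\<close> between
  \<open>0\<close> and \<open>(y - x) \<bullet> (g y - g x)\<close>, so continuity of the selection \<open>g\<close> alone yields differentiability.
  It serves both for the cumulant function and for its conjugate.\<close>

lemma GDERIV_continuous_subgradient:
  fixes f :: "'a::euclidean_space \<Rightarrow> real"
  assumes S: "open S" "x \<in> S"
    and sub: "\<And>y z. y \<in> S \<Longrightarrow> z \<in> S \<Longrightarrow> f y + (z - y) \<bullet> g y \<le> f z"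
    and cont: "continuous_on S g"
  shows "GDERIV f x :> g x"
  unfolding gderiv_def has_derivative_at_alt
proof (intro conjI allI impI)
  show "bounded_linear (\<lambda>h. h \<bullet> g x)" by (rule bounded_linear_inner_left)
  fix e :: real assume e: "0 < e"
  have "isCont g x" using cont S continuous_on_eq_continuous_at by blast
  then obtain d1 where d1: "d1 > 0" "\<And>y. dist y x < d1 \<Longrightarrow> dist (g y) (g x) < e"
    using e unfolding continuous_at_eps_delta by (meson)
  obtain d2 where d2: "d2 > 0" "ball x d2 \<subseteq> S" using S open_contains_ball by blast
  show "\<exists>d>0. \<forall>y. norm (y - x) < d \<longrightarrow> norm (f y - f x - (y - x) \<bullet> g x) \<le> e * norm (y - x)"
  proof (intro exI[of _ "min d1 d2"] conjI allI impI)
    show "0 < min d1 d2" using d1 d2 by simp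
    fix y assume y: "norm (y - x) < min d1 d2"
    then have yS: "y \<in> S" using d2 by (auto simp: dist_norm norm_minus_commute)
    have "norm (g y - g x) < e" using d1(2)[of y] y by (auto simp: dist_norm)
    have 1: "f x + (y - x) \<bullet> g x \<le> f y" using sub S yS by blast
    have 2: "f y + (x - y) \<bullet> g y \<le> f x" using sub S yS by blast
    have "f y - f x - (y - x) \<bullet> g x \<le> (y - x) \<bullet> (g y - g x)"
      using 2 by (simp add: inner_diff_left inner_diff_right)
    also have "\<dots> \<le> norm (y - x) * norm (g y - g x)" by (rule norm_cauchy_schwarz)
    also have "\<dots> \<le> norm (y - x) * e" using \<open>norm (g y - g x) < e\<close> by (intro mult_left_mono) auto
    finally show "norm (f y - f x - (y - x) \<bullet> g x) \<le> e * norm (y - x)"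
      using 1 by (simp add: mult.commute)
  qed
qed

lemma GDERIV_unique:
  assumes "GDERIV f x :> D" "GDERIV f x :> D'"
  shows "D = D'"
proof -
  have eq: "(\<lambda>h. h \<bullet> D) = (\<lambda>h. h \<bullet> D')"
    using assms unfolding gderiv_def by (rule has_derivative_unique)
  have "h \<bullet> D = h \<bullet> D'" for h using fun_cong[OF eq, of h] .
  then show ?thesis using vector_eq_ldot[of D D'] by simp
qed

lemma grad_eqI: "GDERIV (\<lambda>y. real_of_ereal (f y)) x :> D \<Longrightarrow> grad f x = D"
  unfolding grad_def by (rule the_equality) (auto dest: GDERIV_unique)

text \<open>Compare \<open>y\<close> with the point at distance \<open>r\<close> from \<open>x\<close> on the segment from \<open>x\<close> to \<open>y\<close>.\<close>

lemma convex_on_linear_growth: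
  fixes f :: "'a::real_normed_vector \<Rightarrow> real"
  assumes f: "convex_on S f" and x: "x \<in> S" and y: "y \<in> S" and r: "0 < r" "r \<le> norm (y - x)"
    and sph: "\<And>z. z \<in> S \<Longrightarrow> norm (z - x) = r \<Longrightarrow> f x + d \<le> f z"
  shows "f x + d / r * norm (y - x) \<le> f y"
proof -
  define s where "s = r / norm (y - x)"
  have ny: "0 < norm (y - x)" using r by linarith
  have s: "0 < s" "s \<le> 1" using r ny by (auto simp: s_def)
  define z where "z = (1 - s) *\<^sub>R x + s *\<^sub>R y"
  have zS: "z \<in> S"
    using convex_on_imp_convex[OF f] x y s unfolding z_def by (intro convexD_alt) auto
  have "z - x = s *\<^sub>R (y - x)" by (simp add: z_def algebra_simps)
  then have "norm (z - x) = r" using s ny r by (simp add: s_def)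
  then have "f x + d \<le> f z" using sph zS by blast
  also have "f z \<le> (1 - s) * f x + s * f y"
    unfolding z_def using s by (intro convex_onD[OF f] x y) auto
  finally have "d \<le> s * (f y - f x)" by (simp add: algebra_simps)
  then have "d * norm (y - x) \<le> r * (f y - f x)"
    using ny by (simp add: s_def field_simps)
  then show ?thesis using r by (simp add: field_simps)
qed

lemma exists_large_Basis_component:
  fixes y :: "'a::euclidean_space"
  assumes "r \<le> norm y"
  obtains i where "i \<in> Basis" "r / DIM('a) \<le> \<bar>i \<bullet> y\<bar>"
proof (rule ccontr)
  assume "\<not> thesis"
  then have "\<And>i. i \<in> Basis \<Longrightarrow> \<bar>y \<bullet> i\<bar> < r / DIM('a)" using that by (force simp: inner_commute)
  then have "(\<Sum>i\<in>Basis. \<bar>y \<bullet> i\<bar>) < (\<Sum>i\<in>(Basis::'a set). r / DIM('a))"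
    by (intro sum_strict_mono) auto
  then show False using norm_le_l1[of y] assms by simp
qed

section \<open>Cumulant and mean of a regular exponential family\<close>

locale regular_exponential_family =
  fixes lam :: "'a::euclidean_space measure"
  assumes sets_lam: "sets lam = sets borel"
    and sigma_finite_lam: "sigma_finite_measure lam"
    and full: "\<And>A. affine A \<Longrightarrow> A \<noteq> UNIV \<Longrightarrow> \<not> (AE y in lam. y \<in> A)"
    and open_domain: "open (cgf_domain lam)"
begin

lemma space_lam [simp]: "space lam = UNIV"
  using sets_eq_imp_space_eq[OF sets_lam] by simp

lemma measurable_lam_eq [simp]: "measurable lam N = measurable borel N"
  by (rule measurable_cong_sets) (auto simp: sets_lam)

definition \<kappa> :: "'a \<Rightarrow> real" where
  "\<kappa> \<theta> = real_of_ereal (cgf lam \<theta>)"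

definition log_dens :: "'a \<Rightarrow> 'a \<Rightarrow> real" where
  "log_dens \<theta> x = \<theta> \<bullet> x - \<kappa> \<theta>"

definition mean_param :: "'a \<Rightarrow> 'a" where
  "mean_param \<theta> = (\<integral>x. exp (log_dens \<theta> x) *\<^sub>R x \<partial>lam)"

lemma log_dens_measurable [measurable]: "log_dens \<theta> \<in> borel_measurable borel"
  unfolding log_dens_def by measurable

text \<open>The empty set is a proper affine subset, so \<open>lam\<close> is not the null measure. This keeps the cumulant
  function away from \<open>- \<infinity>\<close>.\<close>

lemma partition_function_pos: "0 < (\<integral>\<^sup>+ x. ennreal (exp (\<theta> \<bullet> x)) \<partial>lam)"
proof -
  have "\<not> (AE y in lam. y \<in> ({}::'a set))" by (rule full) auto
  moreover have "AE y in lam. y \<in> ({}::'a set)"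
    if "(\<integral>\<^sup>+ x. ennreal (exp (\<theta> \<bullet> x)) \<partial>lam) = 0"
    using that by (subst (asm) nn_integral_0_iff_AE) (auto elim: eventually_mono)
  ultimately show ?thesis by (meson not_gr_zero)
qed

lemma cgf_domain_iff: "\<theta> \<in> cgf_domain lam \<longleftrightarrow> integrable lam (\<lambda>x. exp (\<theta> \<bullet> x))"
proof -
  have "integrable lam (\<lambda>x. exp (\<theta> \<bullet> x)) \<longleftrightarrow> (\<integral>\<^sup>+ x. ennreal (exp (\<theta> \<bullet> x)) \<partial>lam) < \<infinity>"
    by (auto simp: integrable_iff_bounded)
  then show ?thesis
    by (auto simp: cgf_domain_def cgf_def ln_ennreal_def less_top)
qed

lemma cgf_eq:
  assumes "\<theta> \<in> cgf_domain lam" shows "cgf lam \<theta> = ereal (\<kappa> \<theta>)"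
  using assms partition_function_pos[of \<theta>]
  by (auto simp: \<kappa>_def cgf_domain_def cgf_def ln_ennreal_def)

lemma cgf_outside: "\<theta> \<notin> cgf_domain lam \<Longrightarrow> cgf lam \<theta> = \<infinity>"
  by (simp add: cgf_domain_def)

lemma exp_\<kappa>:
  assumes "\<theta> \<in> cgf_domain lam" shows "exp (\<kappa> \<theta>) = (\<integral>x. exp (\<theta> \<bullet> x) \<partial>lam)"
proof -
  have i: "integrable lam (\<lambda>x. exp (\<theta> \<bullet> x))" using assms cgf_domain_iff by blast
  have *: "(\<integral>\<^sup>+ x. ennreal (exp (\<theta> \<bullet> x)) \<partial>lam) = ennreal (\<integral>x. exp (\<theta> \<bullet> x) \<partial>lam)"
    by (rule nn_integral_eq_integral[OF i]) auto
  have pos: "0 < (\<integral>x. exp (\<theta> \<bullet> x) \<partial>lam)"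
    using partition_function_pos[of \<theta>] by (simp add: * )
  then show ?thesis
    by (simp add: \<kappa>_def cgf_def ln_ennreal_def * )
qed

lemma
  assumes "\<theta> \<in> cgf_domain lam"
  shows integrable_dens: "integrable lam (\<lambda>x. exp (log_dens \<theta> x))"
    and integral_dens: "(\<integral>x. exp (log_dens \<theta> x) \<partial>lam) = 1"
  using assms cgf_domain_iff[of \<theta>] exp_\<kappa>[of \<theta>]
  by (simp_all add: log_dens_def exp_diff flip: exp_\<kappa>)

lemma convex_cgf_domain: "convex (cgf_domain lam)"
  unfolding convex_alt
proof (intro ballI allI impI)
  fix a b and u :: real assume a: "a \<in> cgf_domain lam" and b: "b \<in> cgf_domain lam"
    and u: "0 \<le> u \<and> u \<le> 1"
  show "(1 - u) *\<^sub>R a + u *\<^sub>R b \<in> cgf_domain lam"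
    unfolding cgf_domain_iff
  proof (rule Bochner_Integration.integrable_bound)
    show "integrable lam (\<lambda>x. (1 - u) * exp (a \<bullet> x) + u * exp (b \<bullet> x))"
      using a b by (auto simp: cgf_domain_iff)
    have "exp ((1 - u) * s + u * t) \<le> (1 - u) * exp s + u * exp t" for s t :: real
      using convex_onD[OF exp_convex, of u s t] u by auto
    then show "AE x in lam. norm (exp (((1 - u) *\<^sub>R a + u *\<^sub>R b) \<bullet> x))
        \<le> norm ((1 - u) * exp (a \<bullet> x) + u * exp (b \<bullet> x))"
      using u by (auto simp: inner_add_left)
  qed simp
qed

text \<open>Room in all coordinate directions inside the open domain is room for the norm in the exponent: the
  norm is at most \<open>DIM('a)\<close> times the largest absolute coordinate.\<close>

lemma exp_norm_integrable:
  assumes "\<theta> \<in> cgf_domain lam"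
  obtains e where "0 < e" "integrable lam (\<lambda>x. exp (\<theta> \<bullet> x + e * norm x))"
proof -
  obtain d where d: "0 < d" "cball \<theta> d \<subseteq> cgf_domain lam"
    using open_domain assms open_contains_cball by blast
  define e where "e = d / DIM('a)"
  have "integrable lam (\<lambda>x. exp (\<theta> \<bullet> x + e * norm x))"
  proof (rule Bochner_Integration.integrable_bound)
    let ?w = "\<lambda>x. \<Sum>i\<in>Basis. exp ((\<theta> + d *\<^sub>R i) \<bullet> x) + exp ((\<theta> - d *\<^sub>R i) \<bullet> x)"
    show "integrable lam ?w"
    proof (intro Bochner_Integration.integrable_sum Bochner_Integration.integrable_add)
      fix i :: 'a assume i: "i \<in> Basis"
      have "\<theta> + d *\<^sub>R i \<in> cball \<theta> d" "\<theta> - d *\<^sub>R i \<in> cball \<theta> d"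
        using i d by (auto simp: dist_norm)
      then show "integrable lam (\<lambda>x. exp ((\<theta> + d *\<^sub>R i) \<bullet> x))"
        "integrable lam (\<lambda>x. exp ((\<theta> - d *\<^sub>R i) \<bullet> x))"
        using d cgf_domain_iff by blast+
    qed
    have "exp (\<theta> \<bullet> x + e * norm x) \<le> ?w x" for x
    proof -
      obtain i where i: "i \<in> Basis" "norm x / DIM('a) \<le> \<bar>i \<bullet> x\<bar>"
        using exists_large_Basis_component[of "norm x" x] by auto
      have "e * norm x \<le> d * \<bar>i \<bullet> x\<bar>"
        using mult_left_mono[OF i(2), of d] d by (simp add: e_def)
      then have "exp (\<theta> \<bullet> x + e * norm x) \<le> exp (\<theta> \<bullet> x + d * \<bar>i \<bullet> x\<bar>)" by simp
      also have "\<dots> \<le> exp ((\<theta> + d *\<^sub>R i) \<bullet> x) + exp ((\<theta> - d *\<^sub>R i) \<bullet> x)"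
        by (cases "0 \<le> i \<bullet> x") (auto simp: inner_add_left inner_diff_left)
      also have "\<dots> \<le> ?w x"
        using i(1) by (intro member_le_sum) auto
      finally show ?thesis .
    qed
    then show "AE x in lam. norm (exp (\<theta> \<bullet> x + e * norm x)) \<le> norm (?w x)"
      by (intro AE_I2) (simp add: order_trans[OF _ abs_ge_self])
  qed simp
  then show thesis using that[of e] d by (simp add: e_def)
qed

text \<open>One integrable function dominates both integrands, of the partition function and of the mean,
  uniformly near \<open>\<theta>\<close>. Half of the exponential room pays for moving \<open>\<theta>'\<close>, the other half for the
  factor \<open>norm x\<close>.\<close>

lemma dominated_near:
  assumes "\<theta> \<in> cgf_domain lam"
  obtains e w where "0 < e" "ball \<theta> e \<subseteq> cgf_domain lam" "integrable lam w"
    "\<And>\<theta>' x. \<theta>' \<in> ball \<theta> e \<Longrightarrow> exp (\<theta>' \<bullet> x) \<le> w x"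
    "\<And>\<theta>' x. \<theta>' \<in> ball \<theta> e \<Longrightarrow> norm (exp (\<theta>' \<bullet> x) *\<^sub>R x) \<le> w x"
proof -
  obtain d where d: "0 < d" "integrable lam (\<lambda>x. exp (\<theta> \<bullet> x + d * norm x))"
    using exp_norm_integrable[OF assms] .
  define e where "e = d / 2"
  have e: "0 < e" using d by (simp add: e_def)
  define w where "w x = (1 + 1 / e) * exp (\<theta> \<bullet> x + d * norm x)" for x
  have w: "integrable lam w" unfolding w_def using d by simp
  have le: "\<theta>' \<bullet> x \<le> \<theta> \<bullet> x + e * norm x" if "\<theta>' \<in> ball \<theta> e" for \<theta>' x
  proof -
    have "(\<theta>' - \<theta>) \<bullet> x \<le> norm (\<theta>' - \<theta>) * norm x" by (rule norm_cauchy_schwarz)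
    also have "\<dots> \<le> e * norm x"
      using that by (intro mult_right_mono) (auto simp: dist_norm norm_minus_commute)
    finally show ?thesis by (simp add: inner_diff_left)
  qed
  have b1: "exp (\<theta>' \<bullet> x) \<le> w x" if "\<theta>' \<in> ball \<theta> e" for \<theta>' x
  proof -
    have "e * norm x \<le> d * norm x" using d by (intro mult_right_mono) (auto simp: e_def)
    then have "exp (\<theta>' \<bullet> x) \<le> exp (\<theta> \<bullet> x + d * norm x)" using le[OF that, of x] by simp
    also have "\<dots> \<le> w x" using e by (simp add: w_def algebra_simps)
    finally show ?thesis .
  qed
  have b2: "norm (exp (\<theta>' \<bullet> x) *\<^sub>R x) \<le> w x" if "\<theta>' \<in> ball \<theta> e" for \<theta>' x
  proof -
    have "e * norm x \<le> exp (e * norm x)" using exp_ge_add_one_self[of "e * norm x"] by linarith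
    then have n: "norm x \<le> 1 / e * exp (e * norm x)" using e by (simp add: field_simps)
    have "norm (exp (\<theta>' \<bullet> x) *\<^sub>R x) = exp (\<theta>' \<bullet> x) * norm x" by simp
    also have "\<dots> \<le> exp (\<theta> \<bullet> x + e * norm x) * (1 / e * exp (e * norm x))"
      using le[OF that, of x] n by (intro mult_mono) auto
    also have "\<dots> = 1 / e * exp (\<theta> \<bullet> x + d * norm x)"
      by (simp add: e_def algebra_simps flip: exp_add)
    also have "\<dots> \<le> w x" using e by (simp add: w_def algebra_simps)
    finally show ?thesis .
  qed
  have sub: "ball \<theta> e \<subseteq> cgf_domain lam"
    unfolding cgf_domain_iff
  proof (clarsimp simp: subset_iff cgf_domain_iff simp del: mem_ball)
    fix \<theta>' assume "\<theta>' \<in> ball \<theta> e"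
    then show "integrable lam (\<lambda>x. exp (\<theta>' \<bullet> x))"
      using b1 by (intro Bochner_Integration.integrable_bound[OF w])
         (simp_all add: order_trans[OF _ abs_ge_self])
  qed
  show thesis using that[OF e sub w] b1 b2 by blast
qed

lemma continuous_on_\<kappa>: "continuous_on (cgf_domain lam) \<kappa>"
  and integrable_mean: "\<theta> \<in> cgf_domain lam \<Longrightarrow> integrable lam (\<lambda>x. exp (log_dens \<theta> x) *\<^sub>R x)"
  and continuous_on_mean_param: "continuous_on (cgf_domain lam) mean_param"
proof -
  have int: "integrable lam (\<lambda>x. exp (\<theta> \<bullet> x) *\<^sub>R x)" if \<theta>: "\<theta> \<in> cgf_domain lam" for \<theta>
  proof -
    obtain e w where e: "0 < e" "integrable lam w"
      "\<And>\<theta>' x. \<theta>' \<in> ball \<theta> e \<Longrightarrow> norm (exp (\<theta>' \<bullet> x) *\<^sub>R x) \<le> w x"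
      using dominated_near[OF \<theta>] by metis
    show ?thesis
    proof (rule Bochner_Integration.integrable_bound[OF e(2)])
      show "AE x in lam. norm (exp (\<theta> \<bullet> x) *\<^sub>R x) \<le> norm (w x)"
        using e(1) e(3)[of \<theta>] by (intro AE_I2) (simp add: order_trans[OF _ abs_ge_self])
    qed simp
  qed
  have eq: "(\<lambda>x. exp (log_dens \<theta> x) *\<^sub>R x) = (\<lambda>x. exp (- \<kappa> \<theta>) *\<^sub>R (exp (\<theta> \<bullet> x) *\<^sub>R x))" for \<theta>
    by (auto simp: log_dens_def exp_diff exp_minus divide_inverse)
  show "\<theta> \<in> cgf_domain lam \<Longrightarrow> integrable lam (\<lambda>x. exp (log_dens \<theta> x) *\<^sub>R x)"
    unfolding eq by (intro integrable_scaleR_right int)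
  have lim: "(\<lambda>n. \<integral>x. exp (u n \<bullet> x) \<partial>lam) \<longlonglongrightarrow> (\<integral>x. exp (\<theta> \<bullet> x) \<partial>lam)
      \<and> (\<lambda>n. \<integral>x. exp (u n \<bullet> x) *\<^sub>R x \<partial>lam) \<longlonglongrightarrow> (\<integral>x. exp (\<theta> \<bullet> x) *\<^sub>R x \<partial>lam)"
    if \<theta>: "\<theta> \<in> cgf_domain lam" and u: "u \<longlonglongrightarrow> \<theta>" for u \<theta>
  proof -
    obtain e w where e: "0 < e" "integrable lam w"
      "\<And>\<theta>' x. \<theta>' \<in> ball \<theta> e \<Longrightarrow> exp (\<theta>' \<bullet> x) \<le> w x"
      "\<And>\<theta>' x. \<theta>' \<in> ball \<theta> e \<Longrightarrow> norm (exp (\<theta>' \<bullet> x) *\<^sub>R x) \<le> w x"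
      using dominated_near[OF \<theta>] by metis
    have "eventually (\<lambda>n. u n \<in> ball \<theta> e) sequentially"
      using tendstoD[OF u e(1)] by (simp add: dist_commute)
    then obtain N where N: "\<And>n. N \<le> n \<Longrightarrow> u n \<in> ball \<theta> e"
      unfolding eventually_sequentially by blast
    have uN: "(\<lambda>n. u (n + N)) \<longlonglongrightarrow> \<theta>" using u by (rule LIMSEQ_ignore_initial_segment)
    have "(\<lambda>n. \<integral>x. exp (u (n + N) \<bullet> x) \<partial>lam) \<longlonglongrightarrow> (\<integral>x. exp (\<theta> \<bullet> x) \<partial>lam)"
    proof (rule integral_dominated_convergence[where w = w])
      show "AE x in lam. (\<lambda>n. exp (u (n + N) \<bullet> x)) \<longlonglongrightarrow> exp (\<theta> \<bullet> x)"
        by (intro AE_I2 tendsto_exp tendsto_inner uN tendsto_const)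
      show "AE x in lam. norm (exp (u (n + N) \<bullet> x)) \<le> w x" for n
        using e(3)[OF N[of "n + N"]] by simp
    qed (use e(2) in simp_all)
    moreover have "(\<lambda>n. \<integral>x. exp (u (n + N) \<bullet> x) *\<^sub>R x \<partial>lam) \<longlonglongrightarrow> (\<integral>x. exp (\<theta> \<bullet> x) *\<^sub>R x \<partial>lam)"
    proof (rule integral_dominated_convergence[where w = w])
      show "AE x in lam. (\<lambda>n. exp (u (n + N) \<bullet> x) *\<^sub>R x) \<longlonglongrightarrow> exp (\<theta> \<bullet> x) *\<^sub>R x"
        by (intro AE_I2 tendsto_scaleR tendsto_exp tendsto_inner uN tendsto_const)
      show "AE x in lam. norm (exp (u (n + N) \<bullet> x) *\<^sub>R x) \<le> w x" for n
        using e(4)[OF N[of "n + N"]] by (intro AE_I2) simp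
    qed (use e(2) in simp_all)
    ultimately show ?thesis by (intro conjI) (rule LIMSEQ_offset, assumption)+
  qed
  have "continuous_on (cgf_domain lam) (\<lambda>\<theta>. \<integral>x. exp (\<theta> \<bullet> x) \<partial>lam)"
    using lim by (auto simp: continuous_on_sequentially o_def)
  then have "continuous_on (cgf_domain lam) (\<lambda>\<theta>. ln (\<integral>x. exp (\<theta> \<bullet> x) \<partial>lam))"
    by (intro continuous_on_ln) (auto simp flip: exp_\<kappa>)
  then show k: "continuous_on (cgf_domain lam) \<kappa>"
    by (rule continuous_on_eq) (simp flip: exp_\<kappa>)
  have "continuous_on (cgf_domain lam) (\<lambda>\<theta>. \<integral>x. exp (\<theta> \<bullet> x) *\<^sub>R x \<partial>lam)"
    using lim by (auto simp: continuous_on_sequentially o_def)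
  then have "continuous_on (cgf_domain lam) (\<lambda>\<theta>. exp (- \<kappa> \<theta>) *\<^sub>R (\<integral>x. exp (\<theta> \<bullet> x) *\<^sub>R x \<partial>lam))"
    by (intro continuous_intros k)
  then show "continuous_on (cgf_domain lam) mean_param"
    unfolding mean_param_def eq integral_scaleR_right .
qed

lemma integral_dens_affine:
  assumes a: "a \<in> cgf_domain lam"
  shows "integrable lam (\<lambda>x. exp (log_dens a x) * (h \<bullet> x + c))"
    and "(\<integral>x. exp (log_dens a x) * (h \<bullet> x + c) \<partial>lam) = h \<bullet> mean_param a + c"
proof -
  have eq: "(\<lambda>x. exp (log_dens a x) * (h \<bullet> x + c))
      = (\<lambda>x. h \<bullet> (exp (log_dens a x) *\<^sub>R x) + c * exp (log_dens a x))"
    by (auto simp: algebra_simps)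
  show "integrable lam (\<lambda>x. exp (log_dens a x) * (h \<bullet> x + c))"
    unfolding eq using integrable_dens[OF a] integrable_mean[OF a]
    by (intro Bochner_Integration.integrable_add integrable_inner_right integrable_mult_right)
  show "(\<integral>x. exp (log_dens a x) * (h \<bullet> x + c) \<partial>lam) = h \<bullet> mean_param a + c"
    unfolding eq mean_param_def
    using integrable_dens[OF a] integrable_mean[OF a] integral_dens[OF a]
    by (subst Bochner_Integration.integral_add)
       (simp_all only: integrable_inner_right integrable_mult_right integral_inner_right
          integral_mult_right_zero mult_1_right)
qed

text \<open>Under \<open>P\<^sub>a\<close> the log-likelihood ratio \<open>u = (b - a) \<bullet> x + \<kappa> a - \<kappa> b\<close> satisfies \<open>E (exp u) = 1\<close>, so
  \<open>1 + u \<le> exp u\<close> gives \<open>E u \<le> 0\<close>, which is the subgradient inequality. Equality would force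
  \<open>u = 0\<close> almost everywhere and put \<open>lam\<close> on a hyperplane.\<close>

lemma strict_subgradient:
  assumes a: "a \<in> cgf_domain lam" and b: "b \<in> cgf_domain lam" and ne: "a \<noteq> b"
  shows "\<kappa> a + (b - a) \<bullet> mean_param a < \<kappa> b"
proof (rule ccontr)
  define c where "c = \<kappa> a - \<kappa> b"
  assume "\<not> ?thesis"
  then have neg: "0 \<le> (b - a) \<bullet> mean_param a + c" by (simp add: c_def)
  have u: "log_dens b x - log_dens a x = (b - a) \<bullet> x + c" for x
    by (simp add: log_dens_def c_def inner_diff_left)
  have eb: "exp (log_dens b x) = exp (log_dens a x) * exp ((b - a) \<bullet> x + c)" for x
    by (simp flip: exp_add u)
  let ?f = "\<lambda>x. exp (log_dens b x) - exp (log_dens a x) - exp (log_dens a x) * ((b - a) \<bullet> x + c)"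
  have nonneg: "0 \<le> ?f x" for x
    using mult_left_mono[OF exp_ge_add_one_self[of "(b - a) \<bullet> x + c"], of "exp (log_dens a x)"]
    by (simp add: eb algebra_simps)
  have int: "integrable lam ?f"
    by (intro Bochner_Integration.integrable_diff integrable_dens integral_dens_affine a b)
  have "integral\<^sup>L lam ?f = 1 - 1 - ((b - a) \<bullet> mean_param a + c)"
    using integrable_dens[OF a] integrable_dens[OF b] integral_dens_affine[OF a]
    by (simp add: integral_dens a b)
  then have "integral\<^sup>L lam ?f = 0"
    using neg integral_nonneg_AE[of ?f lam] nonneg by auto
  then have "AE x in lam. ?f x = 0"
    using integral_nonneg_eq_0_iff_AE[OF int] nonneg by auto
  then have "AE x in lam. x \<in> {x. (b - a) \<bullet> x = - c}"
  proof (rule eventually_mono)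
    fix x assume "?f x = 0"
    then have "exp (log_dens a x) * (exp ((b - a) \<bullet> x + c) - (1 + ((b - a) \<bullet> x + c))) = 0"
      by (simp add: eb algebra_simps)
    then have "ln (exp ((b - a) \<bullet> x + c)) = exp ((b - a) \<bullet> x + c) - 1"
      unfolding ln_exp by simp
    then have "exp ((b - a) \<bullet> x + c) = 1" by (intro ln_eq_minus_one) auto
    then have "(b - a) \<bullet> x + c = 0" by simp
    then show "x \<in> {x. (b - a) \<bullet> x = - c}" by simp
  qed
  moreover have "affine {x. (b - a) \<bullet> x = - c}" by (rule affine_hyperplane)
  moreover have "{x. (b - a) \<bullet> x = - c} \<noteq> UNIV"
  proof
    assume "{x. (b - a) \<bullet> x = - c} = UNIV"
    then have "\<forall>x. (b - a) \<bullet> x = - c" by blast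
    from spec[OF this, of 0] spec[OF this, of "b - a"] show False using ne by simp
  qed
  ultimately show False using full by blast
qed


lemma subgradient:
  assumes "a \<in> cgf_domain lam" "b \<in> cgf_domain lam"
  shows "\<kappa> a + (b - a) \<bullet> mean_param a \<le> \<kappa> b"
  using strict_subgradient[OF assms] by (cases "a = b") auto

text \<open>The first-order remainder of \<open>\<kappa>\<close> is \<open>o(s)\<close>, uniformly over unit directions. In the lower bound this makes
  the exponential weight \<open>s * c\<close> gained at distance \<open>c\<close> from the mean beat the normalization.\<close>

lemma cumulant_remainder_less:
  assumes a: "a \<in> cgf_domain lam" and c: "0 < c"
  obtains s where "0 < s" "\<And>v. norm v = 1 \<Longrightarrow> a + s *\<^sub>R v \<in> cgf_domain lam"
    "\<And>v. norm v = 1 \<Longrightarrow> \<kappa> (a + s *\<^sub>R v) - \<kappa> a - s * (v \<bullet> mean_param a) < s * c"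
proof -
  have "isCont mean_param a"
    using continuous_on_mean_param open_domain a continuous_on_eq_continuous_at by blast
  then obtain d1 where d1: "d1 > 0" "\<And>y. dist y a < d1 \<Longrightarrow> dist (mean_param y) (mean_param a) < c"
    using c unfolding continuous_at_eps_delta by meson
  obtain d2 where d2: "d2 > 0" "ball a d2 \<subseteq> cgf_domain lam"
    using open_domain a open_contains_ball by blast
  define s where "s = min d1 d2 / 2"
  have s: "0 < s" "s < d1" "s < d2" using d1 d2 by (auto simp: s_def min_def)
  show thesis
  proof (rule that[OF s(1)])
    fix v :: 'a assume v: "norm v = 1"
    have "a + s *\<^sub>R v \<in> ball a d2" using v s by (simp add: dist_norm)
    then show D: "a + s *\<^sub>R v \<in> cgf_domain lam" using d2 by blast
    have "norm (mean_param (a + s *\<^sub>R v) - mean_param a) < c"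
      using d1(2)[of "a + s *\<^sub>R v"] v s by (simp add: dist_norm)
    then have "v \<bullet> (mean_param (a + s *\<^sub>R v) - mean_param a) < c"
      using norm_cauchy_schwarz[of v "mean_param (a + s *\<^sub>R v) - mean_param a"] v by simp
    then have "s * (v \<bullet> mean_param (a + s *\<^sub>R v)) < s * (c + v \<bullet> mean_param a)"
      using s by (simp add: inner_diff_right)
    moreover have "\<kappa> (a + s *\<^sub>R v) - s * (v \<bullet> mean_param (a + s *\<^sub>R v)) \<le> \<kappa> a"
      using subgradient[OF D a] by simp
    ultimately show "\<kappa> (a + s *\<^sub>R v) - \<kappa> a - s * (v \<bullet> mean_param a) < s * c"
      by (simp add: algebra_simps)
  qed
qed

lemma grad_cgf:
  assumes "\<theta> \<in> cgf_domain lam" shows "grad (cgf lam) \<theta> = mean_param \<theta>"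
proof (rule grad_eqI)
  show "GDERIV (\<lambda>y. real_of_ereal (cgf lam y)) \<theta> :> mean_param \<theta>"
    using GDERIV_continuous_subgradient[OF open_domain assms subgradient continuous_on_mean_param]
    by (simp add: \<kappa>_def[abs_def])
qed

lemma mean_domain_eq: "mean_domain lam = mean_param ` cgf_domain lam"
  unfolding mean_domain_def by (rule image_cong) (auto simp: grad_cgf)

lemma convex_on_\<kappa>: "convex_on (cgf_domain lam) \<kappa>"
proof (rule convex_onI[OF _ convex_cgf_domain])
  fix u :: real and a b
  assume u: "0 < u" "u < 1" and a: "a \<in> cgf_domain lam" and b: "b \<in> cgf_domain lam"
  define z where "z = (1 - u) *\<^sub>R a + u *\<^sub>R b"
  have z: "z \<in> cgf_domain lam"
    unfolding z_def using u by (intro convexD_alt[OF convex_cgf_domain] a b) auto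
  have "(1 - u) * (\<kappa> z + (a - z) \<bullet> mean_param z) + u * (\<kappa> z + (b - z) \<bullet> mean_param z)
      \<le> (1 - u) * \<kappa> a + u * \<kappa> b"
    using u by (intro add_mono mult_left_mono subgradient z a b) auto
  moreover have "(1 - u) * ((a - z) \<bullet> v) + u * ((b - z) \<bullet> v) = 0" for v
    by (simp add: z_def inner_add_left inner_diff_left algebra_simps)
  ultimately have "\<kappa> z \<le> (1 - u) * \<kappa> a + u * \<kappa> b"
    by (simp add: algebra_simps)
  then show "\<kappa> ((1 - u) *\<^sub>R a + u *\<^sub>R b) \<le> (1 - u) * \<kappa> a + u * \<kappa> b"
    by (simp only: z_def)
qed

section \<open>Minimizers of the tilted cumulant function\<close>

text \<open>The set is closed in the whole space, not just in the domain: along a sequence in it, Fatou's lemma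
  bounds the partition function at the limit, so that the limit is in the domain as well.\<close>

lemma closed_sublevel: "closed {\<theta> \<in> cgf_domain lam. \<kappa> \<theta> - \<theta> \<bullet> t \<le> a}"
  unfolding closed_sequential_limits
proof (intro allI impI, elim conjE)
  fix u \<theta> assume u: "\<forall>n. u n \<in> {\<theta> \<in> cgf_domain lam. \<kappa> \<theta> - \<theta> \<bullet> t \<le> a}" and lim: "u \<longlonglongrightarrow> \<theta>"
  have Z: "(\<integral>\<^sup>+ x. ennreal (exp (\<theta> \<bullet> x)) \<partial>lam) = ennreal (exp (\<kappa> \<theta>))"
    if "\<theta> \<in> cgf_domain lam" for \<theta>
    using that by (subst nn_integral_eq_integral) (auto simp: exp_\<kappa> simp flip: cgf_domain_iff)
  have "(\<integral>\<^sup>+ x. ennreal (exp (\<theta> \<bullet> x)) \<partial>lam) = (\<integral>\<^sup>+ x. liminf (\<lambda>n. ennreal (exp (u n \<bullet> x))) \<partial>lam)"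
    by (intro nn_integral_cong lim_imp_Liminf[symmetric] tendsto_ennrealI tendsto_exp tendsto_inner
        lim tendsto_const) simp
  also have "\<dots> \<le> liminf (\<lambda>n. \<integral>\<^sup>+ x. ennreal (exp (u n \<bullet> x)) \<partial>lam)"
    by (rule nn_integral_liminf) simp
  also have "\<dots> \<le> liminf (\<lambda>n. ennreal (exp (a + u n \<bullet> t)))"
  proof (intro Liminf_mono always_eventually allI)
    fix n show "(\<integral>\<^sup>+ x. ennreal (exp (u n \<bullet> x)) \<partial>lam) \<le> ennreal (exp (a + u n \<bullet> t))"
      using u by (auto simp: Z algebra_simps intro!: ennreal_leI)
  qed
  also have "\<dots> = ennreal (exp (a + \<theta> \<bullet> t))"
    by (intro lim_imp_Liminf tendsto_ennrealI tendsto_exp tendsto_add tendsto_inner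
        lim tendsto_const) simp
  finally have le: "(\<integral>\<^sup>+ x. ennreal (exp (\<theta> \<bullet> x)) \<partial>lam) \<le> ennreal (exp (a + \<theta> \<bullet> t))" .
  then have "(\<integral>\<^sup>+ x. ennreal (exp (\<theta> \<bullet> x)) \<partial>lam) < \<infinity>"
    by (rule order_le_less_trans) simp
  then have \<theta>: "\<theta> \<in> cgf_domain lam"
    unfolding cgf_domain_iff by (auto simp: integrable_iff_bounded)
  with le have "exp (\<kappa> \<theta>) \<le> exp (a + \<theta> \<bullet> t)"
    by (simp add: Z)
  with \<theta> show "\<theta> \<in> {\<theta> \<in> cgf_domain lam. \<kappa> \<theta> - \<theta> \<bullet> t \<le> a}" by simp
qed

text \<open>The log-likelihood of \<open>\<theta>\<close> at sample mean \<open>t\<close> is \<open>\<theta> \<bullet> t - \<kappa> \<theta>\<close> per observation.\<close>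

definition is_mle :: "'a set \<Rightarrow> 'a \<Rightarrow> 'a \<Rightarrow> bool" where
  "is_mle S t \<theta> \<longleftrightarrow> \<theta> \<in> S \<and> (\<forall>\<theta>'\<in>S. \<kappa> \<theta> - \<theta> \<bullet> t \<le> \<kappa> \<theta>' - \<theta>' \<bullet> t)"

text \<open>Move from \<open>a\<close> towards \<open>b\<close>: minimality bounds the change of \<open>\<kappa> \<theta> - \<theta> \<bullet> t\<close> from below by \<open>0\<close>, and the
  subgradient at the moved point bounds it from above.\<close>

lemma is_mle_variational:
  assumes ml: "is_mle S t a" and S: "convex S" "S \<subseteq> cgf_domain lam" and b: "b \<in> S"
  shows "0 \<le> (b - a) \<bullet> (mean_param a - t)"
proof -
  define p where "p s = a + s *\<^sub>R (b - a)" for s :: real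
  have a: "a \<in> S" using ml by (simp add: is_mle_def)
  have pS: "p s \<in> S" if "0 \<le> s" "s \<le> 1" for s
  proof -
    have "p s = (1 - s) *\<^sub>R a + s *\<^sub>R b" by (simp add: p_def algebra_simps)
    then show ?thesis using convexD_alt[OF S(1) a b] that by simp
  qed
  have nonneg: "0 \<le> (b - a) \<bullet> (mean_param (p s) - t)" if s: "0 < s" "s \<le> 1" for s
  proof -
    have p: "p s \<in> S" using pS s by simp
    have "\<kappa> a - a \<bullet> t \<le> \<kappa> (p s) - p s \<bullet> t" using ml p by (simp add: is_mle_def)
    moreover have "\<kappa> (p s) + (a - p s) \<bullet> mean_param (p s) \<le> \<kappa> a"
      using p a S(2) by (intro subgradient) auto
    ultimately have "0 \<le> (p s - a) \<bullet> (mean_param (p s) - t)"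
      by (simp add: inner_diff_left inner_diff_right)
    then have "0 \<le> s * ((b - a) \<bullet> (mean_param (p s) - t))" by (simp add: p_def)
    then show ?thesis using s by (simp add: zero_le_mult_iff)
  qed
  have "p 0 = a" by (simp add: p_def)
  moreover have "((\<lambda>s. mean_param (p s)) \<longlongrightarrow> mean_param a) (at_right 0)"
  proof (rule isCont_tendsto_compose[where g = mean_param])
    show "isCont mean_param a"
      using continuous_on_mean_param open_domain a S(2) continuous_on_eq_continuous_at by blast
    have "((\<lambda>s. a + s *\<^sub>R (b - a)) \<longlongrightarrow> a + 0 *\<^sub>R (b - a)) (at_right 0)"
      by (intro tendsto_intros)
    then show "(p \<longlongrightarrow> a) (at_right 0)" by (simp add: p_def[abs_def])
  qed
  then have "((\<lambda>s. (b - a) \<bullet> (mean_param (p s) - t)) \<longlongrightarrow> (b - a) \<bullet> (mean_param a - t)) (at_right 0)"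
    by (intro tendsto_intros)
  moreover have "eventually (\<lambda>s. 0 \<le> (b - a) \<bullet> (mean_param (p s) - t)) (at_right 0)"
    using nonneg by (intro eventually_at_rightI[of 0 1]) auto
  ultimately show ?thesis
    by (intro tendsto_lowerbound[where F = "at_right (0::real)"]) auto
qed

lemma is_mle_strict:
  assumes ml: "is_mle S t a" and S: "convex S" "S \<subseteq> cgf_domain lam" and b: "b \<in> S" "b \<noteq> a"
  shows "\<kappa> a - a \<bullet> t < \<kappa> b - b \<bullet> t"
proof -
  have "a \<in> cgf_domain lam" "b \<in> cgf_domain lam" using ml S b by (auto simp: is_mle_def)
  then have "\<kappa> a + (b - a) \<bullet> mean_param a < \<kappa> b" using b by (intro strict_subgradient) auto
  then show ?thesis
    using is_mle_variational[OF ml S b(1)] by (simp add: inner_diff_left inner_diff_right)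
qed

lemma is_mle_unique:
  assumes "is_mle S t a" "is_mle S t b" "convex S" "S \<subseteq> cgf_domain lam"
  shows "a = b"
  using is_mle_strict[OF assms(1,3,4), of b] assms(2) assms(1)
  by (fastforce simp: is_mle_def)

text \<open>On the open domain a minimizer is interior, so the variational inequality holds in every direction
  and forces a critical point.\<close>

lemma is_mle_cgf_domain_iff:
  "is_mle (cgf_domain lam) t \<theta> \<longleftrightarrow> \<theta> \<in> cgf_domain lam \<and> mean_param \<theta> = t"
proof
  assume "\<theta> \<in> cgf_domain lam \<and> mean_param \<theta> = t"
  then show "is_mle (cgf_domain lam) t \<theta>"
    using subgradient[of \<theta>] by (fastforce simp: is_mle_def inner_diff_left)
next
  assume ml: "is_mle (cgf_domain lam) t \<theta>"
  then have \<theta>: "\<theta> \<in> cgf_domain lam" by (simp add: is_mle_def)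
  then obtain e where e: "0 < e" "cball \<theta> e \<subseteq> cgf_domain lam"
    using open_domain open_contains_cball by blast
  have "mean_param \<theta> = t"
  proof (rule ccontr)
    define v where "v = mean_param \<theta> - t"
    assume "mean_param \<theta> \<noteq> t"
    then have v: "v \<noteq> 0" by (simp add: v_def)
    define b where "b = \<theta> - (e / norm v) *\<^sub>R v"
    have "b \<in> cball \<theta> e" using e v by (simp add: b_def dist_norm)
    then have "0 \<le> (b - \<theta>) \<bullet> v"
      unfolding v_def using e by (intro is_mle_variational[OF ml convex_cgf_domain]) auto
    moreover have "(b - \<theta>) \<bullet> v = - (e / norm v) * (v \<bullet> v)" by (simp add: b_def)
    moreover have "0 < (e / norm v) * (v \<bullet> v)" using e v by (intro mult_pos_pos) auto
    ultimately show False by simp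
  qed
  with \<theta> show "\<theta> \<in> cgf_domain lam \<and> mean_param \<theta> = t" by simp
qed

lemma mean_domain_iff: "t \<in> mean_domain lam \<longleftrightarrow> (\<exists>\<theta>. is_mle (cgf_domain lam) t \<theta>)"
  by (auto simp: is_mle_cgf_domain_iff mean_domain_eq)

text \<open>On the sphere of radius \<open>r\<close> within \<open>S\<close>, which is compact, the minimum is exceeded by a positive amount;
  convexity propagates this outwards linearly.\<close>

lemma is_mle_growth:
  assumes ml: "is_mle S t a" and S: "convex S" "closedin (top_of_set (cgf_domain lam)) S"
    and r: "0 < r" "cball a r \<subseteq> cgf_domain lam"
  obtains d where "0 < d"
    "\<And>b. b \<in> S \<Longrightarrow> r \<le> norm (b - a) \<Longrightarrow> \<kappa> a - a \<bullet> t + d * norm (b - a) \<le> \<kappa> b - b \<bullet> t"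
proof -
  have sub: "S \<subseteq> cgf_domain lam" using closedin_imp_subset[OF S(2)] .
  have aS: "a \<in> S" using ml by (simp add: is_mle_def)
  obtain C where C: "closed C" "S = cgf_domain lam \<inter> C" using S(2) unfolding closedin_closed by blast
  define K where "K = S \<inter> sphere a r"
  have "K = sphere a r \<inter> C" using r C unfolding K_def by auto
  then have K: "compact K" using C by (simp add: compact_Int_closed)
  have cont: "continuous_on K (\<lambda>b. \<kappa> b - b \<bullet> t)"
    by (intro continuous_intros continuous_on_subset[OF continuous_on_\<kappa>]) (use sub in \<open>auto simp: K_def\<close>)
  obtain c where c: "0 < c" "\<And>b. b \<in> K \<Longrightarrow> \<kappa> a - a \<bullet> t + c \<le> \<kappa> b - b \<bullet> t"
  proof (cases "K = {}")
    case True then show ?thesis using that[of 1] by simp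
  next
    case False
    then obtain m where m: "m \<in> K" "\<And>b. b \<in> K \<Longrightarrow> \<kappa> m - m \<bullet> t \<le> \<kappa> b - b \<bullet> t"
      using continuous_attains_inf[OF K False cont] by blast
    have "\<kappa> a - a \<bullet> t < \<kappa> m - m \<bullet> t"
      using m(1) r by (intro is_mle_strict[OF ml S(1) sub]) (auto simp: K_def)
    then show ?thesis using m(2) that[of "\<kappa> m - m \<bullet> t - (\<kappa> a - a \<bullet> t)"] by simp
  qed
  have "convex_on S (\<lambda>b. \<kappa> b + - (b \<bullet> t))"
    using S(1) sub
    by (intro convex_on_add convex_on_subset[OF convex_on_\<kappa>])
       (auto simp: convex_on_def inner_add_left algebra_simps)
  then have cv: "convex_on S (\<lambda>b. \<kappa> b - b \<bullet> t)" by simp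
  show thesis
  proof (rule that)
    show "0 < c / r" using c r by simp
    fix b assume "b \<in> S" "r \<le> norm (b - a)"
    then show "\<kappa> a - a \<bullet> t + c / r * norm (b - a) \<le> \<kappa> b - b \<bullet> t"
      using c r by (intro convex_on_linear_growth[OF cv aS])
        (auto simp: K_def dist_norm norm_minus_commute)
  qed
qed

text \<open>Growth around the unconstrained minimizer, which exists exactly for \<open>t\<close> in the mean domain, makes the
  closed sublevel set bounded.\<close>

lemma compact_sublevel:
  assumes "t \<in> mean_domain lam"
  shows "compact {\<theta> \<in> cgf_domain lam. \<kappa> \<theta> - \<theta> \<bullet> t \<le> c}"
proof -
  obtain a where ml: "is_mle (cgf_domain lam) t a" using assms mean_domain_iff by blast
  then obtain r where r: "0 < r" "cball a r \<subseteq> cgf_domain lam"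
    using open_domain open_contains_cball unfolding is_mle_def by blast
  obtain d where d: "0 < d" "\<And>b. b \<in> cgf_domain lam \<Longrightarrow> r \<le> norm (b - a) \<Longrightarrow>
      \<kappa> a - a \<bullet> t + d * norm (b - a) \<le> \<kappa> b - b \<bullet> t"
    using is_mle_growth[OF ml convex_cgf_domain _ r] by auto
  have "norm (b - a) \<le> max r ((c - (\<kappa> a - a \<bullet> t)) / d)"
    if b: "b \<in> cgf_domain lam" "\<kappa> b - b \<bullet> t \<le> c" for b
  proof (cases "r \<le> norm (b - a)")
    case True
    then have "norm (b - a) \<le> (c - (\<kappa> a - a \<bullet> t)) / d"
      using d(2)[OF b(1)] b(2) d(1) by (simp add: field_simps)
    then show ?thesis by simp
  qed simp
  then have "{\<theta> \<in> cgf_domain lam. \<kappa> \<theta> - \<theta> \<bullet> t \<le> c} \<subseteq> cball a (max r ((c - (\<kappa> a - a \<bullet> t)) / d))"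
    by (auto simp: dist_norm norm_minus_commute)
  then show ?thesis
    using closed_sublevel bounded_subset[OF bounded_cball] compact_eq_bounded_closed by blast
qed

lemma is_mle_exists:
  assumes S: "closedin (top_of_set (cgf_domain lam)) S" "S \<noteq> {}"
    and t: "t \<in> mean_domain lam"
  shows "\<exists>a. is_mle S t a"
proof -
  obtain C where C: "closed C" "S = cgf_domain lam \<inter> C" using S(1) unfolding closedin_closed by blast
  obtain s where s: "s \<in> S" using S by blast
  define K where "K = {\<theta> \<in> cgf_domain lam. \<kappa> \<theta> - \<theta> \<bullet> t \<le> \<kappa> s - s \<bullet> t} \<inter> C"
  have "compact K" unfolding K_def using C compact_sublevel[OF t] by (intro compact_Int_closed) auto
  moreover have sK: "s \<in> K" using s C by (auto simp: K_def)
  moreover have "continuous_on K (\<lambda>b. \<kappa> b - b \<bullet> t)"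
    by (intro continuous_intros continuous_on_subset[OF continuous_on_\<kappa>]) (auto simp: K_def)
  ultimately obtain a where a: "a \<in> K" "\<And>b. b \<in> K \<Longrightarrow> \<kappa> a - a \<bullet> t \<le> \<kappa> b - b \<bullet> t"
    using continuous_attains_inf[of K "\<lambda>b. \<kappa> b - b \<bullet> t"] by blast
  have "\<kappa> a - a \<bullet> t \<le> \<kappa> b - b \<bullet> t" if "b \<in> S" for b
  proof (cases "b \<in> K")
    case False
    then have "\<kappa> s - s \<bullet> t < \<kappa> b - b \<bullet> t" using that C by (auto simp: K_def)
    then show ?thesis using a(2)[OF sK] by simp
  qed (rule a)
  then show ?thesis using a(1) C unfolding is_mle_def K_def by blast
qed

text \<open>Changing \<open>t\<close> to \<open>u\<close> tilts the objective by a linear function of slope \<open>norm (u - t)\<close>. While the slope is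
  below the rate of growth, no competitor at distance \<open>r\<close> or more can win.\<close>

lemma is_mle_perturb:
  assumes ml: "is_mle S t a" and S: "convex S" "closedin (top_of_set (cgf_domain lam)) S"
    and r: "0 < r" "cball a r \<subseteq> cgf_domain lam"
  obtains d where "0 < d"
    "\<And>u b. norm (u - t) < d \<Longrightarrow> b \<in> S \<Longrightarrow> r \<le> norm (b - a) \<Longrightarrow> \<kappa> a - a \<bullet> u < \<kappa> b - b \<bullet> u"
proof -
  obtain d where d: "0 < d"
    "\<And>b. b \<in> S \<Longrightarrow> r \<le> norm (b - a) \<Longrightarrow> \<kappa> a - a \<bullet> t + d * norm (b - a) \<le> \<kappa> b - b \<bullet> t"
    using is_mle_growth[OF assms] by blast
  show thesis
  proof (rule that[OF d(1)])
    fix u b assume u: "norm (u - t) < d" and b: "b \<in> S" "r \<le> norm (b - a)"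
    have "(b - a) \<bullet> (u - t) \<le> norm (b - a) * norm (u - t)" by (rule norm_cauchy_schwarz)
    also have "\<dots> < norm (b - a) * d" using u b r by (intro mult_strict_left_mono) auto
    finally have "(b - a) \<bullet> (u - t) < d * norm (b - a)" by (simp add: mult.commute)
    then show "\<kappa> a - a \<bullet> u < \<kappa> b - b \<bullet> u"
      using d(2)[OF b] by (simp add: inner_diff_left inner_diff_right)
  qed
qed

text \<open>For \<open>u\<close> near \<open>t\<close> a minimizer over a closed ball in the domain exists by compactness and is global by
  \<open>is_mle_perturb\<close>.\<close>

lemma open_mean_domain: "open (mean_domain lam)"
  unfolding open_dist
proof
  fix t assume "t \<in> mean_domain lam"
  then obtain a where ml: "is_mle (cgf_domain lam) t a" using mean_domain_iff by blast
  then obtain r where r: "0 < r" "cball a r \<subseteq> cgf_domain lam"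
    using open_domain open_contains_cball unfolding is_mle_def by blast
  obtain d where d: "0 < d" "\<And>u b. norm (u - t) < d \<Longrightarrow> b \<in> cgf_domain lam \<Longrightarrow>
      r \<le> norm (b - a) \<Longrightarrow> \<kappa> a - a \<bullet> u < \<kappa> b - b \<bullet> u"
    using is_mle_perturb[OF ml convex_cgf_domain _ r] by auto
  have "u \<in> mean_domain lam" if u: "dist u t < d" for u
  proof -
    have "continuous_on (cball a r) (\<lambda>b. \<kappa> b - b \<bullet> u)"
      by (intro continuous_intros continuous_on_subset[OF continuous_on_\<kappa> r(2)])
    then obtain m where m: "m \<in> cball a r" "\<And>b. b \<in> cball a r \<Longrightarrow> \<kappa> m - m \<bullet> u \<le> \<kappa> b - b \<bullet> u"
      using continuous_attains_inf[OF compact_cball, of a r "\<lambda>b. \<kappa> b - b \<bullet> u"] r(1) by auto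
    have "\<kappa> m - m \<bullet> u \<le> \<kappa> b - b \<bullet> u" if "b \<in> cgf_domain lam" for b
    proof (cases "b \<in> cball a r")
      case False
      then have "r \<le> norm (b - a)" by (simp add: dist_norm norm_minus_commute)
      then have "\<kappa> a - a \<bullet> u < \<kappa> b - b \<bullet> u" using d(2) u that by (simp add: dist_norm)
      then show ?thesis using m(2)[of a] r(1) by simp
    qed (rule m)
    then have "is_mle (cgf_domain lam) u m" using m(1) r(2) by (auto simp: is_mle_def)
    then show ?thesis using mean_domain_iff by blast
  qed
  then show "\<exists>e>0. \<forall>y. dist y t < e \<longrightarrow> y \<in> mean_domain lam" using d(1) by blast
qed

text \<open>The objective for a convex combination of \<open>t\<close> and \<open>u\<close> is the convex combination of their objectives. A point
  where the objective for \<open>t\<close> exceeds its value at the minimizer \<open>a\<close> for \<open>u\<close> cannot improve on \<open>a\<close>,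
  so only a compact sublevel set for \<open>t\<close> has to be searched.\<close>

lemma convex_mean_domain: "convex (mean_domain lam)"
  unfolding convex_alt
proof (intro ballI allI impI)
  fix t u and s :: real
  assume t: "t \<in> mean_domain lam" and u: "u \<in> mean_domain lam" and "0 \<le> s \<and> s \<le> 1"
  then consider (one) "s = 1" | (less) "0 \<le> s" "s < 1" by linarith
  then show "(1 - s) *\<^sub>R t + s *\<^sub>R u \<in> mean_domain lam"
  proof cases
    case s: less
    define v where "v = (1 - s) *\<^sub>R t + s *\<^sub>R u"
    obtain a where a: "is_mle (cgf_domain lam) u a" using u mean_domain_iff by blast
    then have aD: "a \<in> cgf_domain lam" by (simp add: is_mle_def)
    have split: "\<kappa> b - b \<bullet> v = (1 - s) * (\<kappa> b - b \<bullet> t) + s * (\<kappa> b - b \<bullet> u)" for b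
      by (simp add: v_def inner_add_right algebra_simps)
    define K where "K = {b \<in> cgf_domain lam. \<kappa> b - b \<bullet> t \<le> \<kappa> a - a \<bullet> t}"
    have cont: "continuous_on K (\<lambda>b. \<kappa> b - b \<bullet> v)"
      by (intro continuous_intros continuous_on_subset[OF continuous_on_\<kappa>]) (auto simp: K_def)
    have aK: "a \<in> K" using aD by (simp add: K_def)
    obtain m where m: "m \<in> K" "\<And>b. b \<in> K \<Longrightarrow> \<kappa> m - m \<bullet> v \<le> \<kappa> b - b \<bullet> v"
      using continuous_attains_inf[of K "\<lambda>b. \<kappa> b - b \<bullet> v"] compact_sublevel[OF t] aK cont
      unfolding K_def by blast
    have "\<kappa> m - m \<bullet> v \<le> \<kappa> b - b \<bullet> v" if b: "b \<in> cgf_domain lam" for b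
    proof (cases "b \<in> K")
      case False
      then have "(1 - s) * (\<kappa> a - a \<bullet> t) + s * (\<kappa> a - a \<bullet> u) \<le> (1 - s) * (\<kappa> b - b \<bullet> t) + s * (\<kappa> b - b \<bullet> u)"
        using a b s by (intro add_mono mult_left_mono) (auto simp: K_def is_mle_def)
      then show ?thesis using m(2)[OF aK] unfolding split by linarith
    qed (rule m)
    then have "is_mle (cgf_domain lam) v m" using m(1) by (auto simp: is_mle_def K_def)
    then show ?thesis unfolding v_def mean_domain_iff by blast
  qed (use u in simp)
qed

section \<open>The maximum likelihood map and its continuity\<close>

definition mle :: "'a set \<Rightarrow> 'a \<Rightarrow> 'a" where
  "mle S t = (SOME \<theta>. is_mle S t \<theta>)"

lemma is_mle_mle:
  assumes "closedin (top_of_set (cgf_domain lam)) S" "S \<noteq> {}" "t \<in> mean_domain lam"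
  shows "is_mle S t (mle S t)"
  unfolding mle_def using is_mle_exists[OF assms] by (rule someI_ex)

lemma mle_eqI:
  assumes "convex S" "S \<subseteq> cgf_domain lam" "is_mle S t a"
  shows "mle S t = a"
  unfolding mle_def using assms by (blast intro: some_equality is_mle_unique)

text \<open>By \<open>is_mle_perturb\<close>, the minimizer for a nearby \<open>u\<close> stays within any prescribed radius.\<close>

lemma continuous_on_mle:
  assumes S: "convex S" "closedin (top_of_set (cgf_domain lam)) S" "S \<noteq> {}"
  shows "continuous_on (mean_domain lam) (mle S)"
  unfolding continuous_on_iff
proof (intro ballI allI impI)
  fix t and e :: real assume t: "t \<in> mean_domain lam" and e: "0 < e"
  have sub: "S \<subseteq> cgf_domain lam" using closedin_imp_subset[OF S(2)] .
  define a where "a = mle S t"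
  have ml: "is_mle S t a" unfolding a_def using is_mle_mle[OF S(2,3) t] .
  then obtain r0 where r0: "0 < r0" "cball a r0 \<subseteq> cgf_domain lam"
    using open_domain sub open_contains_cball unfolding is_mle_def by blast
  define r where "r = min r0 e"
  have r: "0 < r" "cball a r \<subseteq> cgf_domain lam" using r0 e by (auto simp: r_def)
  obtain d where d: "0 < d" "\<And>u b. norm (u - t) < d \<Longrightarrow> b \<in> S \<Longrightarrow>
      r \<le> norm (b - a) \<Longrightarrow> \<kappa> a - a \<bullet> u < \<kappa> b - b \<bullet> u"
    using is_mle_perturb[OF ml S(1,2) r] by blast
  have "dist (mle S u) a < e" if u: "u \<in> mean_domain lam" "dist u t < d" for u
  proof (rule ccontr)
    assume "\<not> dist (mle S u) a < e"
    then have "r \<le> norm (mle S u - a)" by (simp add: r_def dist_norm)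
    moreover have mu: "is_mle S u (mle S u)" using is_mle_mle[OF S(2,3) u(1)] .
    ultimately have "\<kappa> a - a \<bullet> u < \<kappa> (mle S u) - mle S u \<bullet> u"
      using d(2)[of u "mle S u"] u(2) by (simp add: is_mle_def dist_norm)
    then show False using mu ml unfolding is_mle_def by force
  qed
  then show "\<exists>d>0. \<forall>x'\<in>mean_domain lam. dist x' t < d \<longrightarrow> dist (mle S x') (mle S t) < e"
    using d(1) unfolding a_def by blast
qed

lemma mle_mean_param:
  assumes "convex S" "S \<subseteq> cgf_domain lam" "\<theta> \<in> S"
  shows "mle S (mean_param \<theta>) = \<theta>"
proof (rule mle_eqI[OF assms(1,2)])
  have "is_mle (cgf_domain lam) (mean_param \<theta>) \<theta>" using assms is_mle_cgf_domain_iff by blast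
  then show "is_mle S (mean_param \<theta>) \<theta>" using assms by (auto simp: is_mle_def)
qed

text \<open>Without a constraint, maximizing the likelihood inverts \<open>mean_param\<close>.\<close>

definition natural_param :: "'a \<Rightarrow> 'a" where
  "natural_param = mle (cgf_domain lam)"

lemma
  assumes "t \<in> mean_domain lam"
  shows natural_param_in: "natural_param t \<in> cgf_domain lam"
    and mean_natural_param: "mean_param (natural_param t) = t"
proof -
  have "cgf_domain lam \<noteq> {}" using assms by (auto simp: mean_domain_eq)
  then have "is_mle (cgf_domain lam) t (natural_param t)"
    unfolding natural_param_def using assms by (intro is_mle_mle) auto
  then show "natural_param t \<in> cgf_domain lam" "mean_param (natural_param t) = t"
    by (auto simp: is_mle_cgf_domain_iff)
qed

lemma continuous_on_natural_param: "continuous_on (mean_domain lam) natural_param"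
proof (cases "cgf_domain lam = {}")
  case True then show ?thesis by (simp add: mean_domain_eq)
next
  case False then show ?thesis
    unfolding natural_param_def by (intro continuous_on_mle convex_cgf_domain) auto
qed

lemma natural_param_mean: "\<theta> \<in> cgf_domain lam \<Longrightarrow> natural_param (mean_param \<theta>) = \<theta>"
  unfolding natural_param_def by (rule mle_mean_param[OF convex_cgf_domain order_refl])

text \<open>The supremum defining the conjugate is attained at the maximum likelihood point; parameters outside
  the domain contribute \<open>- \<infinity>\<close>.\<close>

lemma cgf_conjugate_eq:
  assumes t: "t \<in> mean_domain lam"
  shows "cgf_conjugate lam t = ereal (natural_param t \<bullet> t - \<kappa> (natural_param t))"
  unfolding cgf_conjugate_def
proof (rule SUP_eqI)
  fix \<theta> show "ereal (\<theta> \<bullet> t) - cgf lam \<theta> \<le> ereal (natural_param t \<bullet> t - \<kappa> (natural_param t))"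
  proof (cases "\<theta> \<in> cgf_domain lam")
    case True
    have "\<kappa> (natural_param t) + (\<theta> - natural_param t) \<bullet> t \<le> \<kappa> \<theta>"
      using subgradient[OF natural_param_in[OF t] True] by (simp add: mean_natural_param t)
    then show ?thesis by (simp add: cgf_eq True inner_diff_left)
  qed (simp add: cgf_outside)
next
  fix y assume "\<And>i. i \<in> UNIV \<Longrightarrow> ereal (i \<bullet> t) - cgf lam i \<le> y"
  from this[of "natural_param t"]
  show "ereal (natural_param t \<bullet> t - \<kappa> (natural_param t)) \<le> y"
    by (simp add: cgf_eq natural_param_in t)
qed

lemma grad_cgf_conjugate:
  assumes t: "t \<in> mean_domain lam"
  shows "grad (cgf_conjugate lam) t = natural_param t"
proof (rule grad_eqI, rule GDERIV_continuous_subgradient[OF open_mean_domain t])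
  show "continuous_on (mean_domain lam) natural_param" by (rule continuous_on_natural_param)
  fix y z assume y: "y \<in> mean_domain lam" and z: "z \<in> mean_domain lam"
  have "\<kappa> (natural_param z) + (natural_param y - natural_param z) \<bullet> z \<le> \<kappa> (natural_param y)"
    using subgradient[OF natural_param_in[OF z] natural_param_in[OF y]]
    by (simp add: mean_natural_param z)
  then show "real_of_ereal (cgf_conjugate lam y) + (z - y) \<bullet> natural_param y
      \<le> real_of_ereal (cgf_conjugate lam z)"
    by (simp add: cgf_conjugate_eq y z inner_diff_left inner_diff_right inner_commute)
qed

section \<open>Log-likelihood ratios and Kullback-Leibler divergence\<close>

definition llr :: "'a \<Rightarrow> 'a \<Rightarrow> 'a \<Rightarrow> real" where
  "llr \<theta> \<theta>' y = log_dens \<theta> y - log_dens \<theta>' y"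

lemma llr_eq: "llr \<theta> \<theta>' y = (\<theta> - \<theta>') \<bullet> y - \<kappa> \<theta> + \<kappa> \<theta>'"
  by (simp add: llr_def log_dens_def inner_diff_left)

lemma llr_measurable [measurable]: "llr b a \<in> borel_measurable borel"
  unfolding llr_def[abs_def] by measurable

lemma KL_param_eq:
  assumes a: "a \<in> cgf_domain lam" and b: "b \<in> cgf_domain lam"
  shows "KL_param lam a b = llr a b (mean_param a)"
proof -
  have "KL_param lam a b
      = (\<integral>x. exp (log_dens a x) * log (exp 1) (exp (log_dens a x) / exp (log_dens b x)) \<partial>lam)"
    unfolding KL_param_def exp_family_def log_dens_def \<kappa>_def
    by (rule sigma_finite_measure.KL_density_density[OF sigma_finite_lam]) auto
  also have "\<dots> = (\<integral>x. exp (log_dens a x) * ((a - b) \<bullet> x + (\<kappa> b - \<kappa> a)) \<partial>lam)"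
    by (intro Bochner_Integration.integral_cong refl)
       (simp add: log_def log_dens_def inner_diff_left flip: exp_diff)
  also have "\<dots> = llr a b (mean_param a)"
    by (simp add: integral_dens_affine[OF a] llr_eq)
  finally show ?thesis .
qed

lemma m_projection_iff:
  assumes a: "a \<in> cgf_domain lam" and S: "S \<subseteq> cgf_domain lam"
  shows "m_projection lam S a \<theta> \<longleftrightarrow> is_mle S (mean_param a) \<theta>"
proof -
  have "KL_param lam a b < KL_param lam a c \<longleftrightarrow>
      \<kappa> b - b \<bullet> mean_param a < \<kappa> c - c \<bullet> mean_param a"
    if "b \<in> S" "c \<in> S" for b c
    using that S a by (subst (1 2) KL_param_eq) (auto simp: llr_eq inner_diff_left)
  then show ?thesis
    unfolding m_projection_def is_arg_min_def is_mle_def by (auto simp flip: not_less)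
qed

lemma constrained_MLE_iff:
  assumes S: "convex S" "closedin (top_of_set (cgf_domain lam)) S" "S \<noteq> {}"
  shows "constrained_MLE lam S \<phi> \<longleftrightarrow> (\<forall>t\<in>mean_domain lam. \<phi> t = mle S t)"
proof -
  have sub: "S \<subseteq> cgf_domain lam" using closedin_imp_subset[OF S(2)] .
  have "m_projection lam S (grad (cgf_conjugate lam) t) \<theta> \<longleftrightarrow> \<theta> = mle S t"
    if t: "t \<in> mean_domain lam" for t \<theta>
    using is_mle_mle[OF S(2,3) t] is_mle_unique[OF _ _ S(1) sub, of t]
    by (auto simp: grad_cgf_conjugate t m_projection_iff[OF natural_param_in[OF t] sub]
        mean_natural_param)
  moreover have "\<phi> \<in> borel_measurable (restrict_space borel (mean_domain lam))"
    if "\<forall>t\<in>mean_domain lam. \<phi> t = mle S t"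
    using continuous_on_mle[OF S] that
    by (intro borel_measurable_continuous_on_restrict)
       (auto cong: continuous_on_cong)
  ultimately show ?thesis unfolding constrained_MLE_def by blast
qed

text \<open>One half of the Pythagorean inequality for the projection on a convex set: the difference of the two
  sides is the variational expression at the estimate in the direction of \<open>b\<close>.\<close>

lemma KL_mle_le_llr:
  assumes S: "convex S" "closedin (top_of_set (cgf_domain lam)) S" and b: "b \<in> S"
    and t: "t \<in> mean_domain lam"
  shows "KL_param lam (mle S t) b \<le> llr (mle S t) b t"
proof -
  have sub: "S \<subseteq> cgf_domain lam" using closedin_imp_subset[OF S(2)] .
  have ml: "is_mle S t (mle S t)" using b by (intro is_mle_mle S(2) t) auto
  then have "0 \<le> (b - mle S t) \<bullet> (mean_param (mle S t) - t)"
    using S(1) sub b by (intro is_mle_variational)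
  moreover have "mle S t \<in> cgf_domain lam" using ml sub by (auto simp: is_mle_def)
  ultimately show ?thesis using b sub
    by (subst KL_param_eq) (auto simp: llr_eq inner_diff_left inner_diff_right)
qed


section \<open>Level sets of the rate function\<close>

text \<open>A hyperplane through \<open>t\<close> strictly separates it from the open convex mean domain, hence from almost every
  \<open>x\<close>. Moving the parameter from \<open>a\<close> along the outward normal \<open>v\<close> sends
  \<open>exp (\<theta> \<bullet> (x - t))\<close> to \<open>0\<close> for almost every \<open>x\<close>, dominated by its value at the start; its integral is,
  up to a constant factor, \<open>exp (- llr \<theta> a t)\<close>.\<close>

lemma llr_unbounded_outside:
  assumes a: "a \<in> cgf_domain lam" and AE: "AE x in lam. x \<in> mean_domain lam"
    and t: "t \<notin> mean_domain lam"
  shows "\<exists>b\<in>cgf_domain lam. c < llr b a t"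
proof -
  have "mean_domain lam \<noteq> {}" using a by (auto simp: mean_domain_eq)
  then obtain v m where v: "v \<noteq> 0" "\<forall>x\<in>mean_domain lam. v \<bullet> x \<le> m" "\<forall>x\<in>{t}. m \<le> v \<bullet> x"
    using separating_hyperplane_sets[OF convex_mean_domain convex_singleton[of t]] t by auto
  have neg: "v \<bullet> x - v \<bullet> t < 0" if x: "x \<in> mean_domain lam" for x
  proof -
    obtain e where e: "0 < e" "cball x e \<subseteq> mean_domain lam"
      using open_mean_domain x open_contains_cball by blast
    have "x + (e / norm v) *\<^sub>R v \<in> cball x e" using v e by (simp add: dist_norm)
    then have "v \<bullet> (x + (e / norm v) *\<^sub>R v) \<le> v \<bullet> t" using v e by force
    moreover have "0 < (e / norm v) * (v \<bullet> v)" using e v by (intro mult_pos_pos) auto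
    ultimately show ?thesis by (simp add: inner_add_right)
  qed
  define F where "F n x = exp (a \<bullet> x) * exp (real n * (v \<bullet> x - v \<bullet> t))" for n x
  have w: "integrable lam (\<lambda>x. exp (a \<bullet> x))" using a cgf_domain_iff by blast
  have bound: "AE x in lam. norm (F n x) \<le> exp (a \<bullet> x)" for n
    using AE
  proof eventually_elim
    case (elim x)
    then have "exp (real n * (v \<bullet> x - v \<bullet> t)) \<le> 1"
      using neg[of x] by (simp add: mult_nonneg_nonpos)
    then show ?case by (simp add: F_def)
  qed
  have lim: "AE x in lam. (\<lambda>n. F n x) \<longlonglongrightarrow> 0"
    using AE
  proof eventually_elim
    case (elim x)
    have "(\<lambda>n. exp (a \<bullet> x) * exp (v \<bullet> x - v \<bullet> t) ^ n) \<longlonglongrightarrow> exp (a \<bullet> x) * 0"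
      using neg[OF elim] by (intro tendsto_mult tendsto_const LIMSEQ_realpow_zero) auto
    then show ?case by (simp add: F_def exp_of_nat_mult)
  qed
  have Fm: "F n \<in> borel_measurable lam" for n unfolding F_def by simp
  have Fi: "integrable lam (F n)" for n
    by (rule Bochner_Integration.integrable_bound[OF w Fm])
       (use bound in \<open>simp add: order_trans[OF _ abs_ge_self]\<close>)
  have "(\<lambda>n. integral\<^sup>L lam (F n)) \<longlonglongrightarrow> integral\<^sup>L lam (\<lambda>x. 0)"
    using lim bound w Fm by (intro integral_dominated_convergence[where w = "\<lambda>x. exp (a \<bullet> x)"]) auto
  then have "eventually (\<lambda>n. integral\<^sup>L lam (F n) < exp (\<kappa> a - c)) sequentially"
    by (intro order_tendstoD) auto
  then obtain n where n: "integral\<^sup>L lam (F n) < exp (\<kappa> a - c)"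
    by (auto simp: eventually_sequentially)
  define b where "b = a + real n *\<^sub>R v"
  have eq: "exp (b \<bullet> x) = exp (real n * (v \<bullet> t)) * F n x" for x
    by (simp add: b_def F_def inner_add_left algebra_simps flip: exp_add)
  have b: "b \<in> cgf_domain lam" unfolding cgf_domain_iff eq using Fi by simp
  have "exp (\<kappa> b) = exp (real n * (v \<bullet> t)) * integral\<^sup>L lam (F n)"
    using b by (simp add: exp_\<kappa> eq)
  also have "\<dots> < exp (real n * (v \<bullet> t)) * exp (\<kappa> a - c)" using n by simp
  finally have "\<kappa> b < real n * (v \<bullet> t) + (\<kappa> a - c)" by (simp flip: exp_add)
  then have "c < llr b a t" by (simp add: llr_eq b_def)
  with b show ?thesis by blast
qed

text \<open>Parameters \<open>a \<plusminus> r *\<^sub>R i\<close> with \<open>i\<close> in the basis bound every coordinate of \<open>y\<close>.\<close>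

lemma finite_bounded_halfspaces:
  assumes a: "a \<in> cgf_domain lam"
  obtains T where "finite T" "T \<subseteq> cgf_domain lam" "\<And>c. bounded {y. \<forall>b\<in>T. llr b a y \<le> c}"
proof -
  obtain r where r: "0 < r" "cball a r \<subseteq> cgf_domain lam"
    using open_domain a open_contains_cball by blast
  define T where "T = (\<lambda>i. a + r *\<^sub>R i) ` Basis \<union> (\<lambda>i. a - r *\<^sub>R i) ` Basis"
  have bdd: "bounded {y. \<forall>b\<in>T. llr b a y \<le> c}" for c
  proof -
    define m where "m = Max (insert 0 ((\<lambda>b. c + \<kappa> b - \<kappa> a) ` T))"
    have fin: "finite T" by (simp add: T_def)
    have "norm y \<le> m / r * DIM('a)" if y: "\<forall>b\<in>T. llr b a y \<le> c" for y
    proof -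
      have "b \<in> T \<Longrightarrow> c + \<kappa> b - \<kappa> a \<le> m" for b
        unfolding m_def using fin by (intro Max_ge) auto
      then have le: "b \<in> T \<Longrightarrow> (b - a) \<bullet> y \<le> m" for b
        using y by (force simp: llr_eq)
      obtain i where i: "i \<in> Basis" "norm y / DIM('a) \<le> \<bar>i \<bullet> y\<bar>"
        using exists_large_Basis_component[of "norm y" y] by auto
      have "r * (i \<bullet> y) \<le> m" "- (r * (i \<bullet> y)) \<le> m"
        using le[of "a + r *\<^sub>R i"] le[of "a - r *\<^sub>R i"] i(1) by (auto simp: T_def)
      then have "r * \<bar>i \<bullet> y\<bar> \<le> m" by (cases "0 \<le> i \<bullet> y") auto
      moreover have "r * (norm y / DIM('a)) \<le> r * \<bar>i \<bullet> y\<bar>" using i r by (intro mult_left_mono) auto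
      ultimately have "r * (norm y / DIM('a)) \<le> m" by linarith
      then show ?thesis using r by (simp add: field_simps)
    qed
    then show ?thesis unfolding bounded_iff by blast
  qed
  have "T \<subseteq> cball a r" using r by (auto simp: T_def dist_norm)
  with r(2) have "T \<subseteq> cgf_domain lam" by (rule order_trans[rotated])
  then show thesis by (rule that[rotated]) (auto simp: bdd, simp add: T_def)
qed

lemma closed_llr_le: "closed {y. llr b a y \<le> c}"
  unfolding llr_eq by (intro closed_Collect_le continuous_intros)

lemma open_llr_gt: "open {y. c < llr b a y}"
  unfolding llr_eq by (intro open_Collect_less continuous_intros)

text \<open>The finitely many half-spaces of \<open>finite_bounded_halfspaces\<close> cover everything but a bounded set;
  compactness handles the rest of \<open>B\<close>.\<close>

lemma finite_halfspace_cover: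
  assumes a: "a \<in> cgf_domain lam" and B: "closed B"
    and cov: "\<And>y. y \<in> B \<Longrightarrow> \<exists>b\<in>cgf_domain lam. c < llr b a y"
  obtains T where "finite T" "T \<subseteq> cgf_domain lam" "\<And>y. y \<in> B \<Longrightarrow> \<exists>b\<in>T. c < llr b a y"
proof -
  obtain T where T: "finite T" "T \<subseteq> cgf_domain lam" "\<And>c. bounded {y. \<forall>b\<in>T. llr b a y \<le> c}"
    using finite_bounded_halfspaces[OF a] by blast
  define K where "K = B \<inter> {y. \<forall>b\<in>T. llr b a y \<le> c}"
  have "{y. \<forall>b\<in>T. llr b a y \<le> c} = (\<Inter>b\<in>T. {y. llr b a y \<le> c})" by auto
  then have "closed {y. \<forall>b\<in>T. llr b a y \<le> c}"
    using closed_llr_le by (simp add: closed_INT)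
  then have "compact K"
    unfolding K_def using T(3)[of c] B by (intro closed_Int_compact) (auto simp: compact_eq_bounded_closed)
  moreover have "K \<subseteq> (\<Union>b\<in>cgf_domain lam. {y. c < llr b a y})"
    using cov by (auto simp: K_def)
  ultimately obtain U where U: "U \<subseteq> cgf_domain lam" "finite U" "K \<subseteq> (\<Union>b\<in>U. {y. c < llr b a y})"
    using compactE_image[of K "cgf_domain lam" "\<lambda>b. {y. c < llr b a y}"] open_llr_gt by metis
  have "\<exists>b\<in>T \<union> U. c < llr b a y" if "y \<in> B" for y
  proof (cases "y \<in> K")
    case True then show ?thesis using U(3) by blast
  next
    case False then show ?thesis using that by (force simp: K_def)
  qed
  then show thesis using that[of "T \<union> U"] T U by blast
qed

lemma llr_le_KL:
  assumes "\<theta> \<in> cgf_domain lam" "a \<in> cgf_domain lam" "b \<in> cgf_domain lam"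
  shows "llr b a (mean_param \<theta>) \<le> KL_param lam \<theta> a"
  using subgradient[OF assms(1,3)] assms by (simp add: KL_param_eq llr_eq inner_diff_left)

lemma KL_param_nonneg:
  assumes "\<theta> \<in> cgf_domain lam" "a \<in> cgf_domain lam"
  shows "0 \<le> KL_param lam \<theta> a"
  using llr_le_KL[OF assms assms(2)] by (simp add: llr_def)

text \<open>Since \<open>D(\<theta>||a)\<close> is the supremum of \<open>llr b a (mean_param \<theta>)\<close> over \<open>b\<close>, the sublevel set corresponds, under
  \<open>mean_param\<close>, to an intersection of closed half-spaces. This intersection is compact, and by
  \<open>llr_unbounded_outside\<close> it stays inside the mean domain, where the inverse of \<open>mean_param\<close> is
  continuous.\<close>

lemma compact_KL_sublevel:
  assumes a: "a \<in> cgf_domain lam" and AE: "AE x in lam. x \<in> mean_domain lam"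
  shows "compact {\<theta> \<in> cgf_domain lam. KL_param lam \<theta> a \<le> c}"
proof -
  define K where "K = {y. \<forall>b\<in>cgf_domain lam. llr b a y \<le> c}"
  obtain T where "finite T" and T: "T \<subseteq> cgf_domain lam" "\<And>c. bounded {y. \<forall>b\<in>T. llr b a y \<le> c}"
    using finite_bounded_halfspaces[OF a] by blast
  have "K \<subseteq> {y. \<forall>b\<in>T. llr b a y \<le> c}" using T(1) by (auto simp: K_def)
  then have "bounded K" by (rule bounded_subset[OF T(2)])
  moreover have "K = (\<Inter>b\<in>cgf_domain lam. {y. llr b a y \<le> c})" by (auto simp: K_def)
  then have "closed K" using closed_llr_le by (simp add: closed_INT)
  ultimately have "compact K" by (simp add: compact_eq_bounded_closed)
  moreover have KM: "K \<subseteq> mean_domain lam"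
    using llr_unbounded_outside[OF a AE, of _ c] by (fastforce simp: K_def)
  ultimately have "compact (natural_param ` K)"
    by (intro compact_continuous_image continuous_on_subset[OF continuous_on_natural_param])
  also have "natural_param ` K = {\<theta> \<in> cgf_domain lam. KL_param lam \<theta> a \<le> c}"
  proof (intro equalityI subsetI)
    fix \<theta> assume "\<theta> \<in> natural_param ` K"
    then obtain y where y: "y \<in> K" "\<theta> = natural_param y" by blast
    then have yM: "y \<in> mean_domain lam" using KM by blast
    have "llr \<theta> a y \<le> c" using y natural_param_in[OF yM] by (auto simp: K_def)
    then show "\<theta> \<in> {\<theta> \<in> cgf_domain lam. KL_param lam \<theta> a \<le> c}"
      using y natural_param_in[OF yM] mean_natural_param[OF yM] by (simp add: KL_param_eq a)
  next
    fix \<theta> assume \<theta>: "\<theta> \<in> {\<theta> \<in> cgf_domain lam. KL_param lam \<theta> a \<le> c}"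
    then have "mean_param \<theta> \<in> K" using llr_le_KL[OF _ a] unfolding K_def by (fastforce)
    then show "\<theta> \<in> natural_param ` K" using \<theta> natural_param_mean[of \<theta>] by (intro image_eqI) auto
  qed
  finally show ?thesis .
qed

lemma good_rate_function_KL:
  assumes S: "closedin (top_of_set (cgf_domain lam)) S" and a: "a \<in> cgf_domain lam"
    and AE: "AE x in lam. x \<in> mean_domain lam"
  shows "good_rate_function (top_of_set S) (\<lambda>\<theta>. ereal (KL_param lam \<theta> a))"
proof -
  have sub: "S \<subseteq> cgf_domain lam" using closedin_imp_subset[OF S] .
  obtain C where C: "closed C" "S = cgf_domain lam \<inter> C" using S unfolding closedin_closed by blast
  have cpt: "compact {\<theta> \<in> S. KL_param lam \<theta> a \<le> c}" for c
  proof -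
    have "{\<theta> \<in> S. KL_param lam \<theta> a \<le> c} = {\<theta> \<in> cgf_domain lam. KL_param lam \<theta> a \<le> c} \<inter> C"
      using C by auto
    then show ?thesis using compact_KL_sublevel[OF a AE] C by (simp add: compact_Int_closed)
  qed
  have "closedin (top_of_set S) {\<theta> \<in> S. ereal (KL_param lam \<theta> a) \<le> e}" for e
  proof (cases e)
    case (real c)
    have "closedin (top_of_set S) {\<theta> \<in> S. KL_param lam \<theta> a \<le> c}"
      using compact_imp_closed[OF cpt[of c]] by (intro closed_subset) auto
    then show ?thesis using real by simp
  qed auto
  then show ?thesis
    unfolding good_rate_function_def using cpt KL_param_nonneg sub a
    by (auto simp: compactin_subtopology)
qed

end

section \<open>Exponential rates\<close>

lemma ln_ennreal_mono: "u \<le> v \<Longrightarrow> ln_ennreal u \<le> ln_ennreal v"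
  unfolding ln_ennreal_def
  by (cases u; cases v) (simp_all add: ennreal_eq_0_iff ennreal_le_iff top_unique)

lemma ln_ennreal_ennreal: "0 < r \<Longrightarrow> ln_ennreal (ennreal r) = ereal (ln r)"
  by (simp add: ln_ennreal_def)

lemma limsup_rate_le:
  assumes N: "0 < N" and le: "\<And>n. 1 \<le> n \<Longrightarrow> p n \<le> ennreal (N * exp (- (real n * c)))"
  shows "limsup (\<lambda>n. ereal (1 / real n) * ln_ennreal (p n)) \<le> ereal (- c)"
proof -
  have "limsup (\<lambda>n. ereal (1 / real n) * ln_ennreal (p n)) \<le> limsup (\<lambda>n. ereal (ln N / real n - c))"
  proof (intro Limsup_mono eventually_sequentiallyI)
    fix n :: nat assume n: "1 \<le> n"
    have "ln_ennreal (p n) \<le> ereal (ln (N * exp (- (real n * c))))"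
      using ln_ennreal_mono[OF le[OF n]] N by (simp add: ln_ennreal_ennreal)
    also have "ln (N * exp (- (real n * c))) = ln N - real n * c" using N by (simp add: ln_mult)
    finally have "ereal (1 / real n) * ln_ennreal (p n) \<le> ereal (1 / real n) * ereal (ln N - real n * c)"
      by (intro ereal_mult_left_mono) auto
    also have "\<dots> = ereal (ln N / real n - c)" using n by (simp add: field_simps)
    finally show "ereal (1 / real n) * ln_ennreal (p n) \<le> ereal (ln N / real n - c)" .
  qed
  also have "(\<lambda>n. ln N / real n - c) \<longlonglongrightarrow> 0 - c"
    by (intro tendsto_diff tendsto_const lim_const_over_n)
  then have "limsup (\<lambda>n. ereal (ln N / real n - c)) = ereal (- c)"
    by (intro lim_imp_Limsup) auto
  finally show ?thesis .
qed

lemma liminf_rate_ge: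
  assumes N: "0 < N" and le: "eventually (\<lambda>n. ennreal (N * exp (- (real n * c))) \<le> p n) sequentially"
  shows "ereal (- c) \<le> liminf (\<lambda>n. ereal (1 / real n) * ln_ennreal (p n))"
proof -
  have "(\<lambda>n. ln N / real n - c) \<longlonglongrightarrow> 0 - c"
    by (intro tendsto_diff tendsto_const lim_const_over_n)
  then have "ereal (- c) = liminf (\<lambda>n. ereal (ln N / real n - c))"
    by (intro lim_imp_Liminf[symmetric]) auto
  also have "\<dots> \<le> liminf (\<lambda>n. ereal (1 / real n) * ln_ennreal (p n))"
  proof (rule Liminf_mono)
    show "eventually (\<lambda>n. ereal (ln N / real n - c) \<le> ereal (1 / real n) * ln_ennreal (p n)) sequentially"
      using le eventually_ge_at_top[of 1]
    proof eventually_elim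
      case (elim n)
      have "ereal (ln N / real n - c) = ereal (1 / real n) * ereal (ln N - real n * c)"
        using elim by (simp add: field_simps)
      also have "ln N - real n * c = ln (N * exp (- (real n * c)))" using N by (simp add: ln_mult)
      also have "ereal \<dots> \<le> ln_ennreal (p n)"
        using ln_ennreal_mono[OF elim(1)] N by (simp add: ln_ennreal_ennreal)
      finally show ?case by (simp add: ereal_mult_left_mono)
    qed
  qed
  finally show ?thesis .
qed

section \<open>Large deviations from the likelihood-ratio identity\<close>

text \<open>What the large deviation bounds use of the law \<open>\<rho> n\<close> of the mean of \<open>n\<close> observations. The last
  assumption says that likelihood ratios have integral \<open>1\<close>; it replaces all reference to the
  underlying sequence of independent variables.\<close>

locale sample_mean_laws = regular_exponential_family lam
  for lam :: "'a::euclidean_space measure" +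
  fixes \<theta>\<^sub>0 :: 'a and \<rho> :: "nat \<Rightarrow> 'a measure"
  assumes \<theta>\<^sub>0: "\<theta>\<^sub>0 \<in> cgf_domain lam"
    and AE_mean_domain: "AE x in lam. x \<in> mean_domain lam"
    and prob_\<rho>: "1 \<le> n \<Longrightarrow> prob_space (\<rho> n)"
    and sets_\<rho>: "sets (\<rho> n) = sets borel"
    and AE_\<rho>: "1 \<le> n \<Longrightarrow> AE y in \<rho> n. y \<in> mean_domain lam"
    and likelihood_ratio_\<rho>: "1 \<le> n \<Longrightarrow> \<theta> \<in> cgf_domain lam \<Longrightarrow>
      (\<integral>\<^sup>+ y. ennreal (exp (real n * llr \<theta> \<theta>\<^sub>0 y)) \<partial>\<rho> n) = 1"
begin

lemma space_\<rho> [simp]: "space (\<rho> n) = UNIV"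
  using sets_eq_imp_space_eq[OF sets_\<rho>[of n]] by simp

lemma measurable_\<rho>_eq [simp]: "measurable (\<rho> n) N = measurable borel N"
  by (rule measurable_cong_sets) (auto simp: sets_\<rho>)

lemma chernoff_bound:
  assumes n: "1 \<le> n" and b: "b \<in> cgf_domain lam"
  shows "emeasure (\<rho> n) {y. c < llr b \<theta>\<^sub>0 y} \<le> ennreal (exp (- (real n * c)))"
proof -
  have s: "{y. c < llr b \<theta>\<^sub>0 y} \<in> sets (\<rho> n)" unfolding sets_\<rho> by measurable
  then have "emeasure (\<rho> n) {y. c < llr b \<theta>\<^sub>0 y} = (\<integral>\<^sup>+ y. indicator {y. c < llr b \<theta>\<^sub>0 y} y \<partial>\<rho> n)"
    by simp
  also have "\<dots> \<le> (\<integral>\<^sup>+ y. ennreal (exp (- (real n * c))) * ennreal (exp (real n * llr b \<theta>\<^sub>0 y)) \<partial>\<rho> n)"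
  proof (intro nn_integral_mono)
    fix y
    have "1 \<le> exp (- (real n * c)) * exp (real n * llr b \<theta>\<^sub>0 y)" if "c < llr b \<theta>\<^sub>0 y"
      using that n by (simp flip: exp_add)
    then show "indicator {y. c < llr b \<theta>\<^sub>0 y} y
        \<le> ennreal (exp (- (real n * c))) * ennreal (exp (real n * llr b \<theta>\<^sub>0 y))"
      by (auto simp: indicator_def simp flip: ennreal_mult)
  qed
  also have "\<dots> = ennreal (exp (- (real n * c)))"
    using likelihood_ratio_\<rho>[OF n b] by (subst nn_integral_cmult) simp_all
  finally show ?thesis .
qed

lemma closed_set_upper_bound:
  assumes B: "closed B" and cov: "\<And>y. y \<in> B \<Longrightarrow> \<exists>b\<in>cgf_domain lam. c < llr b \<theta>\<^sub>0 y"
  obtains N where "0 < N" "\<And>n. 1 \<le> n \<Longrightarrow> emeasure (\<rho> n) B \<le> ennreal (N * exp (- (real n * c)))"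
proof -
  obtain T where T: "finite T" "T \<subseteq> cgf_domain lam" "\<And>y. y \<in> B \<Longrightarrow> \<exists>b\<in>T. c < llr b \<theta>\<^sub>0 y"
    using finite_halfspace_cover[OF \<theta>\<^sub>0 B cov] by blast
  show thesis
  \<comment> \<open>The \<open>+ 1\<close> keeps the constant positive when \<open>B\<close> is empty, so that its logarithm is finite.\<close>
  proof (rule that[of "real (card T) + 1"])
    fix n :: nat assume n: "1 \<le> n"
    have s: "{y. c < llr b \<theta>\<^sub>0 y} \<in> sets (\<rho> n)" for b unfolding sets_\<rho> by measurable
    have "emeasure (\<rho> n) B \<le> emeasure (\<rho> n) (\<Union>b\<in>T. {y. c < llr b \<theta>\<^sub>0 y})"
      using T(1,3) s by (intro emeasure_mono) auto
    also have "\<dots> \<le> (\<Sum>b\<in>T. emeasure (\<rho> n) {y. c < llr b \<theta>\<^sub>0 y})"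
      using T(1) s by (intro emeasure_subadditive_finite) auto
    also have "\<dots> \<le> (\<Sum>b\<in>T. ennreal (exp (- (real n * c))))"
      using T(2) by (intro sum_mono chernoff_bound n) auto
    also have "\<dots> = ennreal (real (card T) * exp (- (real n * c)))"
      by (simp add: ennreal_mult ennreal_of_nat_eq_real_of_nat)
    also have "\<dots> \<le> ennreal ((real (card T) + 1) * exp (- (real n * c)))"
      by (intro ennreal_leI mult_right_mono) auto
    finally show "emeasure (\<rho> n) B \<le> ennreal ((real (card T) + 1) * exp (- (real n * c)))" .
  qed simp
qed

text \<open>The tilted measure with density \<open>exp (n * llr a \<theta>\<^sub>0 y)\<close> has total mass \<open>1\<close>. Outside a small ball around
  the mean \<open>t\<close> of \<open>P\<^sub>a\<close>, some coordinate of \<open>y - t\<close> is large, and there the density is exponentially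
  smaller than the one for a parameter shifted in that coordinate direction, so that the outside
  has mass tending to \<open>0\<close>. Inside the ball the density is at most \<open>exp (n * (D(a||\<theta>\<^sub>0) + \<delta>))\<close>.\<close>

lemma ball_lower_bound:
  assumes a: "a \<in> cgf_domain lam" and r: "0 < r" and \<delta>: "0 < \<delta>"
  shows "eventually (\<lambda>n. ennreal (1 / 2 * exp (- (real n * (KL_param lam a \<theta>\<^sub>0 + \<delta>))))
    \<le> emeasure (\<rho> n) (ball (mean_param a) r)) sequentially"
proof -
  define t where "t = mean_param a"
  define D where "D = KL_param lam a \<theta>\<^sub>0 + \<delta>"
  \<comment> \<open>The second bound keeps \<open>llr a \<theta>\<^sub>0\<close> within \<open>\<delta>\<close> of its value at \<open>t\<close>; the \<open>+ 1\<close> covers \<open>a = \<theta>\<^sub>0\<close>.\<close>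
  define r' where "r' = min r (\<delta> / (norm (a - \<theta>\<^sub>0) + 1))"
  have r': "0 < r'" "r' \<le> r" using r \<delta> by (auto simp: r'_def intro!: divide_pos_pos add_nonneg_pos)
  define U where "U = ball t r'"
  define c where "c = r' / DIM('a)"
  have c: "0 < c" using r' by (simp add: c_def)
  obtain s where s: "0 < s" "\<And>v. norm v = 1 \<Longrightarrow> a + s *\<^sub>R v \<in> cgf_domain lam"
    "\<And>v. norm v = 1 \<Longrightarrow> \<kappa> (a + s *\<^sub>R v) - \<kappa> a - s * (v \<bullet> t) < s * c"
    using cumulant_remainder_less[OF a c] unfolding t_def by blast
  define V where "V = Basis \<union> uminus ` (Basis :: 'a set)"
  have V: "finite V" "\<And>v. v \<in> V \<Longrightarrow> norm v = 1" by (auto simp: V_def)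
  \<comment> \<open>The exponential rate at which the outside of the ball loses mass in direction \<open>v\<close>.\<close>
  define g where "g v = s * c - (\<kappa> (a + s *\<^sub>R v) - \<kappa> a - s * (v \<bullet> t))" for v
  have g: "0 < g v" if "v \<in> V" for v using s(3)[OF V(2)[OF that]] by (simp add: g_def)
  have inU: "llr a \<theta>\<^sub>0 y \<le> D" if "y \<in> U" for y
  proof -
    have "llr a \<theta>\<^sub>0 y = KL_param lam a \<theta>\<^sub>0 + (a - \<theta>\<^sub>0) \<bullet> (y - t)"
      by (simp add: KL_param_eq a \<theta>\<^sub>0 llr_eq inner_diff_right t_def)
    also have "(a - \<theta>\<^sub>0) \<bullet> (y - t) \<le> norm (a - \<theta>\<^sub>0) * norm (y - t)" by (rule norm_cauchy_schwarz)
    also have "\<dots> \<le> (norm (a - \<theta>\<^sub>0) + 1) * (\<delta> / (norm (a - \<theta>\<^sub>0) + 1))"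
      using that by (intro mult_mono) (auto simp: U_def r'_def dist_norm norm_minus_commute)
    also have "\<dots> = \<delta>" using norm_ge_zero[of "a - \<theta>\<^sub>0"] by (simp add: add_nonneg_eq_0_iff)
    finally show ?thesis by (simp add: D_def)
  qed
  have outU: "\<exists>v\<in>V. llr a \<theta>\<^sub>0 y \<le> llr (a + s *\<^sub>R v) \<theta>\<^sub>0 y - g v" if "y \<notin> U" for y
  proof -
    have "r' \<le> norm (y - t)" using that by (simp add: U_def dist_norm norm_minus_commute)
    then obtain i where i: "i \<in> Basis" "c \<le> \<bar>i \<bullet> (y - t)\<bar>"
      using exists_large_Basis_component unfolding c_def by blast
    define v where "v = (if 0 \<le> i \<bullet> (y - t) then i else - i)"
    have "v \<in> V" "c \<le> v \<bullet> (y - t)" using i by (auto simp: v_def V_def)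
    then have "s * c \<le> s * (v \<bullet> (y - t))" using s(1) by (intro mult_left_mono) auto
    then have "llr a \<theta>\<^sub>0 y \<le> llr (a + s *\<^sub>R v) \<theta>\<^sub>0 y - g v"
      by (simp add: llr_eq g_def inner_add_left inner_diff_left inner_diff_right algebra_simps)
    with \<open>v \<in> V\<close> show ?thesis by blast
  qed
  have lower: "1 \<le> exp (real n * D) * measure (\<rho> n) U + (\<Sum>v\<in>V. exp (- (real n * g v)))"
    if n: "1 \<le> n" for n
  proof -
    interpret prob_space "\<rho> n" using prob_\<rho>[OF n] .
    have [measurable]: "U \<in> sets borel" by (simp add: U_def)
    let ?h = "\<lambda>v y. ennreal (exp (- (real n * g v))) * ennreal (exp (real n * llr (a + s *\<^sub>R v) \<theta>\<^sub>0 y))"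
    have "1 = (\<integral>\<^sup>+ y. ennreal (exp (real n * llr a \<theta>\<^sub>0 y)) \<partial>\<rho> n)"
      using likelihood_ratio_\<rho>[OF n a] by simp
    also have "\<dots> \<le> (\<integral>\<^sup>+ y. ennreal (exp (real n * D)) * indicator U y + (\<Sum>v\<in>V. ?h v y) \<partial>\<rho> n)"
    proof (intro nn_integral_mono)
      fix y
      show "ennreal (exp (real n * llr a \<theta>\<^sub>0 y))
        \<le> ennreal (exp (real n * D)) * indicator U y + (\<Sum>v\<in>V. ?h v y)"
      proof (cases "y \<in> U")
        case True
        then have "ennreal (exp (real n * llr a \<theta>\<^sub>0 y)) \<le> ennreal (exp (real n * D)) * indicator U y"
          using inU[OF True] by (auto intro!: ennreal_leI mult_left_mono)
        then show ?thesis by (rule order_trans) simp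
      next
        case False
        then obtain v where v: "v \<in> V" "llr a \<theta>\<^sub>0 y \<le> llr (a + s *\<^sub>R v) \<theta>\<^sub>0 y - g v"
          using outU by blast
        have "real n * llr a \<theta>\<^sub>0 y \<le> real n * (llr (a + s *\<^sub>R v) \<theta>\<^sub>0 y - g v)"
          using v by (intro mult_left_mono) auto
        then have "ennreal (exp (real n * llr a \<theta>\<^sub>0 y)) \<le> ?h v y"
          by (simp add: right_diff_distrib flip: ennreal_mult exp_add)
        also have "\<dots> \<le> (\<Sum>v\<in>V. ?h v y)" using v V by (intro member_le_sum) auto
        finally show ?thesis by (rule order_trans) simp
      qed
    qed
    also have "\<dots> = (\<integral>\<^sup>+ y. ennreal (exp (real n * D)) * indicator U y \<partial>\<rho> n)
        + (\<Sum>v\<in>V. \<integral>\<^sup>+ y. ?h v y \<partial>\<rho> n)"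
      by (subst nn_integral_add) (auto simp: nn_integral_sum)
    also have "(\<integral>\<^sup>+ y. ennreal (exp (real n * D)) * indicator U y \<partial>\<rho> n)
        = ennreal (exp (real n * D) * measure (\<rho> n) U)"
      by (subst nn_integral_cmult) (auto simp: sets_\<rho> emeasure_eq_measure ennreal_mult)
    also have "(\<Sum>v\<in>V. \<integral>\<^sup>+ y. ?h v y \<partial>\<rho> n) = (\<Sum>v\<in>V. ennreal (exp (- (real n * g v))))"
      by (intro sum.cong refl, subst nn_integral_cmult)
         (simp_all add: likelihood_ratio_\<rho>[OF n s(2)[OF V(2)]])
    also have "\<dots> = ennreal (\<Sum>v\<in>V. exp (- (real n * g v)))" by (simp add: sum_ennreal)
    finally have "ennreal 1 \<le> ennreal (exp (real n * D) * measure (\<rho> n) U + (\<Sum>v\<in>V. exp (- (real n * g v))))"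
      by (simp add: sum_nonneg)
    then show ?thesis by (subst (asm) ennreal_le_iff) (auto intro!: add_nonneg_nonneg sum_nonneg)
  qed
  have "(\<lambda>n. \<Sum>v\<in>V. exp (- g v) ^ n) \<longlonglongrightarrow> (\<Sum>v\<in>V. 0)"
    using g by (intro tendsto_sum LIMSEQ_realpow_zero) auto
  then have "(\<lambda>n. \<Sum>v\<in>V. exp (- (real n * g v))) \<longlonglongrightarrow> 0"
    by (simp flip: exp_of_nat_mult)
  then have "eventually (\<lambda>n. (\<Sum>v\<in>V. exp (- (real n * g v))) < 1 / 2) sequentially"
    by (intro order_tendstoD) auto
  then show ?thesis
    using eventually_ge_at_top[of 1]
  proof eventually_elim
    case (elim n)
    interpret prob_space "\<rho> n" using prob_\<rho>[OF elim(2)] .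
    have "1 / 2 \<le> exp (real n * D) * measure (\<rho> n) U" using lower[OF elim(2)] elim(1) by linarith
    then have "1 / 2 * exp (- (real n * D)) \<le> measure (\<rho> n) U"
      by (simp add: exp_minus field_simps)
    then have "ennreal (1 / 2 * exp (- (real n * D))) \<le> emeasure (\<rho> n) U"
      unfolding emeasure_eq_measure by (rule ennreal_leI)
    also have "\<dots> \<le> emeasure (\<rho> n) (ball (mean_param a) r)"
      using r' by (intro emeasure_mono) (auto simp: U_def t_def sets_\<rho>)
    finally show ?case by (simp add: D_def)
  qed
qed

lemma LDP_mle:
  assumes S: "convex S" "closedin (top_of_set (cgf_domain lam)) S" "\<theta>\<^sub>0 \<in> S"
    and \<phi>: "\<And>t. t \<in> mean_domain lam \<Longrightarrow> \<phi> t = mle S t"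
  shows "LDP (top_of_set S)
    (\<lambda>n. distr (restrict_space (\<rho> n) (mean_domain lam)) (restrict_space borel S) \<phi>)
    (\<lambda>\<theta>. ereal (KL_param lam \<theta> \<theta>\<^sub>0))"
proof -
  let ?X = "top_of_set S"
  let ?M = "mean_domain lam"
  let ?I = "\<lambda>\<theta>. ereal (KL_param lam \<theta> \<theta>\<^sub>0)"
  define \<nu> where "\<nu> n = distr (restrict_space (\<rho> n) ?M) (restrict_space borel S) \<phi>" for n
  have sub: "S \<subseteq> cgf_domain lam" using closedin_imp_subset[OF S(2)] .
  have ne: "S \<noteq> {}" using S(3) by blast
  have Ms: "?M \<in> sets borel" using open_mean_domain by simp
  have cont: "continuous_on ?M \<phi>"
    using continuous_on_mle[OF S(1,2) ne] \<phi> by (simp cong: continuous_on_cong)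
  have \<phi>S: "\<phi> t \<in> S" if "t \<in> ?M" for t
    using is_mle_mle[OF S(2) ne that] \<phi>[OF that] by (simp add: is_mle_def)
  have sets_X: "sigma_sets (topspace ?X) {U. openin ?X U} = sets (restrict_space borel S)"
  proof -
    obtain C where "closed C" "S = cgf_domain lam \<inter> C"
      using S(2) unfolding closedin_closed by blast
    then have "S \<in> sets borel" using open_domain by simp
    then have "S \<in> sigma_sets UNIV {U. open U}" by (simp add: borel_def)
    moreover have "{U. openin ?X U} = (\<inter>) S ` {U. open U}" by (auto simp: openin_open)
    ultimately show ?thesis
      by (simp add: sets_restrict_space borel_def sigma_sets_Int)
  qed
  have meas: "\<phi> \<in> measurable (restrict_space (\<rho> n) ?M) (restrict_space borel S)" for n
  proof (rule measurable_restrict_space2)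
    show "\<phi> \<in> space (restrict_space (\<rho> n) ?M) \<rightarrow> S" using \<phi>S by (auto simp: space_restrict_space)
    have "\<phi> \<in> borel_measurable (restrict_space borel ?M)"
      using cont by (rule borel_measurable_continuous_on_restrict)
    then show "\<phi> \<in> borel_measurable (restrict_space (\<rho> n) ?M)"
      by (subst measurable_cong_sets[OF _ refl, of _ "restrict_space borel ?M"])
         (auto simp: sets_restrict_space sets_\<rho>)
  qed
  have em: "emeasure (\<nu> n) A = emeasure (\<rho> n) (\<phi> -` A \<inter> ?M)"
    if "A \<in> sets (restrict_space borel S)" for A n
    unfolding \<nu>_def using that meas Ms
    by (simp add: emeasure_distr emeasure_restrict_space space_restrict_space sets_\<rho>)
  have prob: "prob_space (\<nu> n)" if n: "1 \<le> n" for n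
  proof -
    interpret prob_space "\<rho> n" using prob_\<rho>[OF n] .
    have "emeasure (\<rho> n) ?M = 1" using AE_\<rho>[OF n] Ms by (intro emeasure_eq_1_AE) (auto simp: sets_\<rho>)
    then have "prob_space (restrict_space (\<rho> n) ?M)"
      using Ms by (intro prob_space_restrict_space) (auto simp: sets_\<rho>)
    then show ?thesis unfolding \<nu>_def by (rule prob_space.prob_space_distr[OF _ meas])
  qed
  have lower: "- (INF \<theta>\<in>?X interior_of A. ?I \<theta>)
      \<le> liminf (\<lambda>n. ereal (1 / real n) * ln_ennreal (emeasure (\<nu> n) A))"
    if A: "A \<in> sets (restrict_space borel S)" for A
  proof -
    let ?L = "liminf (\<lambda>n. ereal (1 / real n) * ln_ennreal (emeasure (\<nu> n) A))"
    have "- ?L \<le> ?I \<theta>" if \<theta>: "\<theta> \<in> ?X interior_of A" for \<theta>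
    proof -
      have \<theta>S: "\<theta> \<in> S" using \<theta> interior_of_subset_topspace[of ?X A] by auto
      have \<theta>D: "\<theta> \<in> cgf_domain lam" using \<theta>S sub by blast
      obtain W where W: "open W" "?X interior_of A = S \<inter> W"
        using openin_interior_of[of ?X A] unfolding openin_open by blast
      have "open (\<phi> -` W \<inter> ?M)"
        using continuous_on_open_vimage[OF open_mean_domain, of \<phi>] cont W(1) by blast
      moreover have "mean_param \<theta> \<in> \<phi> -` W \<inter> ?M"
        using \<theta> W \<theta>D mle_mean_param[OF S(1) sub \<theta>S] \<phi>[of "mean_param \<theta>"]
        by (auto simp: mean_domain_eq)
      ultimately obtain r where r: "0 < r" "ball (mean_param \<theta>) r \<subseteq> \<phi> -` W \<inter> ?M"
        using open_contains_ball by blast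
      have ballA: "ball (mean_param \<theta>) r \<subseteq> \<phi> -` A \<inter> ?M"
        using r(2) W(2) \<phi>S interior_of_subset[of ?X A] by blast
      have Am: "\<phi> -` A \<inter> ?M \<in> sets (\<rho> n)" for n
        using measurable_sets[OF meas A, of n] Ms
        by (simp add: space_restrict_space sets_restrict_space_iff sets_\<rho>)
      have bound: "ereal (- (KL_param lam \<theta> \<theta>\<^sub>0 + \<delta>)) \<le> ?L" if "0 < \<delta>" for \<delta>
      proof (rule liminf_rate_ge[of "1 / 2"])
        show "eventually (\<lambda>n. ennreal (1 / 2 * exp (- (real n * (KL_param lam \<theta> \<theta>\<^sub>0 + \<delta>))))
            \<le> emeasure (\<nu> n) A) sequentially"
          using ball_lower_bound[OF \<theta>D r(1) that]
        proof eventually_elim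
          case (elim n)
          also have "emeasure (\<rho> n) (ball (mean_param \<theta>) r) \<le> emeasure (\<nu> n) A"
            unfolding em[OF A] by (rule emeasure_mono[OF ballA Am])
          finally show ?case .
        qed
      qed simp
      have "- ?L \<le> ?I \<theta> + ereal \<delta>" if "0 < \<delta>" for \<delta>
        using bound[OF that] by (subst ereal_uminus_le_reorder) simp
      then show "- ?L \<le> ?I \<theta>" by (rule ereal_le_epsilon2)
    qed
    then have "- ?L \<le> (INF \<theta>\<in>?X interior_of A. ?I \<theta>)" by (rule INF_greatest)
    then show ?thesis by (subst ereal_uminus_le_reorder)
  qed
  have upper: "limsup (\<lambda>n. ereal (1 / real n) * ln_ennreal (emeasure (\<nu> n) A))
      \<le> - (INF \<theta>\<in>?X closure_of A. ?I \<theta>)"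
    if A: "A \<in> sets (restrict_space borel S)" for A
  proof -
    let ?L = "limsup (\<lambda>n. ereal (1 / real n) * ln_ennreal (emeasure (\<nu> n) A))"
    let ?inf = "INF \<theta>\<in>?X closure_of A. ?I \<theta>"
    have AS: "A \<subseteq> S" using sets.sets_into_space[OF A] by (simp add: space_restrict_space)
    obtain C where C: "closed C" "?X closure_of A = S \<inter> C"
      using closedin_closure_of[of ?X A] unfolding closedin_closed by blast
    \<comment> \<open>The preimage of \<open>C\<close> is closed in the mean domain; taking its closure adds only points outside of it.\<close>
    define B where "B = closure (\<phi> -` C \<inter> ?M)"
    have BM: "\<phi> y \<in> ?X closure_of A" if "y \<in> B" "y \<in> ?M" for y
    proof -
      have "closedin (top_of_set ?M) (?M \<inter> \<phi> -` C)"
        using continuous_closedin_preimage[OF cont C(1)] by simp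
      then obtain E where E: "closed E" "?M \<inter> \<phi> -` C = ?M \<inter> E" by (auto simp: closedin_closed)
      have "B \<subseteq> E" unfolding B_def using E by (intro closure_minimal) auto
      then show ?thesis using that E \<phi>S[OF that(2)] C(2) by auto
    qed
    have bound: "?L \<le> ereal (- c)" if c: "ereal c < ?inf" for c
    proof -
      have "\<exists>b\<in>cgf_domain lam. c < llr b \<theta>\<^sub>0 y" if y: "y \<in> B" for y
      proof (cases "y \<in> ?M")
        case True
        have "ereal c < ?I (\<phi> y)" using c INF_lower[OF BM[OF y True], of ?I] by (rule less_le_trans)
        then have "c < llr (\<phi> y) \<theta>\<^sub>0 y"
          using KL_mle_le_llr[OF S True] by (simp add: \<phi> True)
        then show ?thesis using \<phi>S[OF True] sub by blast
      next
        case False then show ?thesis using llr_unbounded_outside[OF \<theta>\<^sub>0 AE_mean_domain] by blast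
      qed
      then obtain N where N: "0 < N"
        "\<And>n. 1 \<le> n \<Longrightarrow> emeasure (\<rho> n) B \<le> ennreal (N * exp (- (real n * c)))"
        using closed_set_upper_bound[of B c] unfolding B_def by (metis closed_closure)
      have "A \<subseteq> C" using closure_of_subset[of A ?X] AS C(2) by auto
      then have le: "emeasure (\<nu> n) A \<le> emeasure (\<rho> n) B" for n
        unfolding em[OF A] B_def
        by (intro emeasure_mono order_trans[OF _ closure_subset]) (auto simp: sets_\<rho>)
      show ?thesis
        by (rule limsup_rate_le[OF N(1)]) (use le N(2) in \<open>blast intro: order_trans\<close>)
    qed
    show ?thesis
    proof (rule ccontr)
      assume "\<not> ?thesis"
      then have "- ?L < ?inf" by (simp add: ereal_uminus_less_reorder not_le)
      then obtain c where "- ?L < ereal c" "ereal c < ?inf" using ereal_dense2 by blast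
      with bound[of c] show False by (simp add: ereal_uminus_less_reorder)
    qed
  qed
  have "AE x in lam. x \<in> ?M" by (rule AE_mean_domain)
  then show ?thesis
    unfolding LDP_def \<nu>_def[symmetric] sets_X
    using prob lower upper good_rate_function_KL[OF S(2) \<theta>\<^sub>0]
    by (auto simp: \<nu>_def space_restrict_space)
qed

end

section \<open>Laws of sample means\<close>

text \<open>The exponent is the sum of the log-likelihood ratios of the observations, so by independence the
  integral is a product of integrals of likelihood ratios of single observations.\<close>

lemma (in regular_exponential_family) likelihood_ratio_sample_mean:
  assumes M: "prob_space M" and indep: "prob_space.indep_vars M (\<lambda>_. borel) x {1..}"
    and law: "\<And>i. i \<ge> 1 \<Longrightarrow> distr M borel (x i) = exp_family lam a"
    and a: "a \<in> cgf_domain lam" and b: "b \<in> cgf_domain lam" and n: "1 \<le> n"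
  shows "(\<integral>\<^sup>+ y. ennreal (exp (real n * llr b a y)) \<partial>distr M borel (sample_mean x n)) = 1"
proof -
  interpret prob_space M by fact
  have rv [measurable]: "x i \<in> borel_measurable M" if "1 \<le> i" for i
    using indep that unfolding indep_vars_def by auto
  have sm: "sample_mean x n \<in> borel_measurable M"
    unfolding sample_mean_def[abs_def] by (intro borel_measurable_scaleR borel_measurable_sum) auto
  have one: "(\<integral>\<^sup>+ \<omega>. ennreal (exp (llr b a (x i \<omega>))) \<partial>M) = 1" if i: "1 \<le> i" for i
  proof -
    have "(\<integral>\<^sup>+ \<omega>. ennreal (exp (llr b a (x i \<omega>))) \<partial>M)
        = (\<integral>\<^sup>+ y. ennreal (exp (llr b a y)) \<partial>distr M borel (x i))"
      using rv[OF i] by (subst nn_integral_distr) auto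
    also have "\<dots> = (\<integral>\<^sup>+ y. ennreal (exp (log_dens a y)) * ennreal (exp (llr b a y)) \<partial>lam)"
      unfolding law[OF i] exp_family_def
      by (subst nn_integral_density) (auto simp: log_dens_def \<kappa>_def)
    also have "\<dots> = (\<integral>\<^sup>+ y. ennreal (exp (log_dens b y)) \<partial>lam)"
      by (intro nn_integral_cong) (simp add: llr_def flip: ennreal_mult exp_add)
    also have "\<dots> = 1"
      using integrable_dens[OF b] integral_dens[OF b] by (subst nn_integral_eq_integral) auto
    finally show ?thesis .
  qed
  have "real n * llr b a (sample_mean x n \<omega>) = (\<Sum>i=1..n. llr b a (x i \<omega>))" for \<omega>
  proof -
    have [simp]: "real n * (inverse (real n) * z) = z" for z using n by simp
    show ?thesis
      by (simp add: llr_eq sample_mean_def sum_subtractf sum.distrib inner_sum_right algebra_simps)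
  qed
  then have "(\<integral>\<^sup>+ y. ennreal (exp (real n * llr b a y)) \<partial>distr M borel (sample_mean x n))
      = (\<integral>\<^sup>+ \<omega>. (\<Prod>i=1..n. ennreal (exp (llr b a (x i \<omega>)))) \<partial>M)"
    using sm by (subst nn_integral_distr) (auto simp: exp_sum prod_ennreal intro!: nn_integral_cong)
  also have "\<dots> = (\<Prod>i=1..n. \<integral>\<^sup>+ \<omega>. ennreal (exp (llr b a (x i \<omega>))) \<partial>M)"
  proof (rule indep_vars_nn_integral)
    have "indep_vars (\<lambda>_. borel) x {1..n}" by (rule indep_vars_subset[OF indep]) auto
    then show "indep_vars (\<lambda>_. borel) (\<lambda>i \<omega>. ennreal (exp (llr b a (x i \<omega>)))) {1..n}"
      by (rule indep_vars_compose2[where Y = "\<lambda>_ y. ennreal (exp (llr b a y))"]) measurable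
  qed auto
  also have "\<dots> = 1" by (simp add: one)
  finally show ?thesis .
qed

lemma (in regular_exponential_family) sample_mean_laws_distr:
  assumes M: "prob_space M" and indep: "prob_space.indep_vars M (\<lambda>_. borel) x {1..}"
    and law: "\<And>i. i \<ge> 1 \<Longrightarrow> distr M borel (x i) = exp_family lam a"
    and a: "a \<in> cgf_domain lam"
    and mean: "\<And>n. n \<ge> 1 \<Longrightarrow> AE \<omega> in M. sample_mean x n \<omega> \<in> mean_domain lam"
  shows "sample_mean_laws lam a (\<lambda>n. distr M borel (sample_mean x n))"
proof (intro sample_mean_laws.intro sample_mean_laws_axioms.intro)
  interpret prob_space M by fact
  show "regular_exponential_family lam" by (rule regular_exponential_family_axioms)
  have rv: "x i \<in> borel_measurable M" if "1 \<le> i" for i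
    using indep that unfolding indep_vars_def by auto
  have sm: "sample_mean x n \<in> borel_measurable M" for n
    unfolding sample_mean_def[abs_def]
    by (intro borel_measurable_scaleR borel_measurable_sum rv) auto
  have Ms: "{y \<in> space borel. y \<in> mean_domain lam} \<in> sets borel" using open_mean_domain by simp
  show AE: "AE y in distr M borel (sample_mean x n). y \<in> mean_domain lam" if "1 \<le> n" for n
    using mean[OF that] Ms by (subst AE_distr_iff[OF sm]) auto
  \<comment> \<open>A sample of size one shows that \<open>P\<^sub>a\<close>, and so \<open>lam\<close>, is carried by the mean domain.\<close>
  have "sample_mean x 1 = x 1" by (auto simp: sample_mean_def)
  then have "AE y in exp_family lam a. y \<in> mean_domain lam"
    using AE[OF order_refl] law[OF order_refl] by (simp only:)
  then show "AE y in lam. y \<in> mean_domain lam"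
    unfolding exp_family_def by (subst (asm) AE_density) auto
  show "a \<in> cgf_domain lam" by (rule a)
  show "prob_space (distr M borel (sample_mean x n))" for n by (rule prob_space_distr[OF sm])
  show "sets (distr M borel (sample_mean x n)) = sets borel" for n by simp
  show "(\<integral>\<^sup>+ y. ennreal (exp (real n * llr \<theta> a y)) \<partial>distr M borel (sample_mean x n)) = 1"
    if "1 \<le> n" "\<theta> \<in> cgf_domain lam" for n \<theta>
    by (rule likelihood_ratio_sample_mean[OF M indep law a that(2,1)])
qed

theorem theorem3p2:
  fixes lam :: "'a::euclidean_space measure"
    and \<Theta> :: "'a set" and \<theta>\<^sub>0 :: 'a
    and M :: "'w measure" and x :: "nat \<Rightarrow> 'w \<Rightarrow> 'a"
  assumes borel: "sets lam = sets borel"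
    and sigma_finite: "sigma_finite_measure lam"
    and full: "\<And>A. affine A \<Longrightarrow> A \<noteq> UNIV \<Longrightarrow> \<not> (AE y in lam. y \<in> A)"
    and open_domain: "open (cgf_domain lam)"
    and convex: "convex \<Theta>"
    and closed: "closedin (top_of_set (cgf_domain lam)) \<Theta>"
    and theta0: "\<theta>\<^sub>0 \<in> \<Theta>"
    and prob: "prob_space M"
    and indep: "prob_space.indep_vars M (\<lambda>_. borel) x {1..}"
    and law: "\<And>i. i \<ge> 1 \<Longrightarrow> distr M borel (x i) = exp_family lam \<theta>\<^sub>0"
    and mean: "\<And>n. n \<ge> 1 \<Longrightarrow> AE \<omega> in M. sample_mean x n \<omega> \<in> mean_domain lam"
  shows "(\<exists>!\<phi>. \<phi> \<in> extensional (mean_domain lam) \<and> constrained_MLE lam \<Theta> \<phi>) \<and>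
         (\<forall>\<phi>. constrained_MLE lam \<Theta> \<phi> \<longrightarrow>
            LDP (top_of_set \<Theta>) (estimator_law M lam \<Theta> \<phi> x) (\<lambda>\<theta>. ereal (KL_param lam \<theta> \<theta>\<^sub>0)))"
proof -
  interpret regular_exponential_family lam
    using borel sigma_finite full open_domain by (rule regular_exponential_family.intro)
  have \<theta>\<^sub>0: "\<theta>\<^sub>0 \<in> cgf_domain lam" using closedin_imp_subset[OF closed] theta0 by blast
  interpret sample_mean_laws lam \<theta>\<^sub>0 "\<lambda>n. distr M borel (sample_mean x n)"
    by (rule sample_mean_laws_distr[OF prob indep law \<theta>\<^sub>0 mean])
  have mle_iff: "constrained_MLE lam \<Theta> \<phi> \<longleftrightarrow> (\<forall>t\<in>mean_domain lam. \<phi> t = mle \<Theta> t)" for \<phi>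
    using theta0 by (intro constrained_MLE_iff convex closed) auto
  have "\<exists>!\<phi>. \<phi> \<in> extensional (mean_domain lam) \<and> constrained_MLE lam \<Theta> \<phi>"
  proof (rule ex1I[of _ "restrict (mle \<Theta>) (mean_domain lam)"])
    show "restrict (mle \<Theta>) (mean_domain lam) \<in> extensional (mean_domain lam) \<and>
        constrained_MLE lam \<Theta> (restrict (mle \<Theta>) (mean_domain lam))"
      by (simp add: mle_iff)
  next
    fix \<phi> assume "\<phi> \<in> extensional (mean_domain lam) \<and> constrained_MLE lam \<Theta> \<phi>"
    then show "\<phi> = restrict (mle \<Theta>) (mean_domain lam)"
      by (intro extensionalityI[where A = "mean_domain lam"]) (auto simp: mle_iff)
  qed
  moreover have "LDP (top_of_set \<Theta>) (estimator_law M lam \<Theta> \<phi> x) (\<lambda>\<theta>. ereal (KL_param lam \<theta> \<theta>\<^sub>0))"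
    if "constrained_MLE lam \<Theta> \<phi>" for \<phi>
    unfolding estimator_law_def[abs_def]
    using that by (intro LDP_mle convex closed theta0) (simp add: mle_iff)
  ultimately show ?thesis by blast
qed

end
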